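(* Let $M$ be a probabilistic Turing machine that recognizes a nonregular language. Suppose that for every input $w$ of length $n$, $M$ runs within space $o(\log\log n)$, halts with some probability $h_w\le 1$ within expected time $T(n)$, and fails to halt with the remaining probability $1-h_w$. Then for every $b<1$, the inequality $\log\log T(n)\ge(\log n)^b$ holds for infinitely many $n$. In particular, $T(n)$ is not bounded above by any polynomial in $n$.
   Context: The probabilistic Turing machine has a two-way read-only input tape containing $\rhd w\lhd$, where $\rhd$ and $\lhd$ are endmarkers. It has one read-write work tape and computable transition probabilities in $[0,1]$, and halts on entering its accept or reject state. $M$ recognizes a language $L$ if there is $\epsilon<1/2$ such that every $w\in L$ is accepted with probability at least $1-\epsilon$ and every $w\notin L$ is rejected with probability at least $1-\epsilon$. The phrase "halts with probability $h_w$ within expected time $T(n)$" means that, conditioned on halting, the expected running time is at most $T(n)$. *)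

theory Defs
  imports
    "HOL-Probability.Probability"
    "HOL-Library.Landau_Symbols"
    "HOL-Computational_Algebra.Polynomial"
begin

(* Deterministic finite automata; the states may be taken to be natural numbers
   without loss of generality. *)
definition regular_lang :: "'a list set \<Rightarrow> bool" where
  "regular_lang L \<longleftrightarrow>
     (\<exists>(Q :: nat set) (\<delta> :: nat \<Rightarrow> 'a \<Rightarrow> nat) q0 F.
        finite Q \<and> q0 \<in> Q \<and> F \<subseteq> Q \<and> (\<forall>q\<in>Q. \<forall>a. \<delta> q a \<in> Q) \<and>
        L = {w. foldl \<delta> q0 w \<in> F})"

datatype recf = Zero | Succ | Proj nat | Comp recf "recf list" | PrimRec recf recf | Mu recf

(* Partial mu-recursive functions, as the graph of each program.
   PrimRec recurses on the head of the argument list; Mu minimises over the head. *)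
inductive computes :: "recf \<Rightarrow> nat list \<Rightarrow> nat \<Rightarrow> bool" where
  "computes Zero xs 0"
| "computes Succ [x] (Suc x)"
| "i < length xs \<Longrightarrow> computes (Proj i) xs (xs ! i)"
| "list_all2 (\<lambda>g y. computes g xs y) gs ys \<Longrightarrow> computes f ys z \<Longrightarrow> computes (Comp f gs) xs z"
| "computes f xs y \<Longrightarrow> computes (PrimRec f g) (0 # xs) y"
| "computes (PrimRec f g) (n # xs) y \<Longrightarrow> computes g (n # y # xs) z \<Longrightarrow>
     computes (PrimRec f g) (Suc n # xs) z"
| "computes f (n # xs) 0 \<Longrightarrow> (\<forall>m<n. \<exists>y>0. computes f (m # xs) y) \<Longrightarrow> computes (Mu f) xs n"

definition total_recursive :: "(nat \<Rightarrow> nat) \<Rightarrow> bool" where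
  "total_recursive F \<longleftrightarrow> (\<exists>f. \<forall>n. computes f [n] (F n))"

(* A difference of two naturals represents the integer numerator. *)
definition computable_real :: "real \<Rightarrow> bool" where
  "computable_real x \<longleftrightarrow>
     (\<exists>F G. total_recursive F \<and> total_recursive G \<and>
        (\<forall>n. \<bar>x - (real (F n) - real (G n)) / 2 ^ n\<bar> \<le> 1 / 2 ^ n))"

datatype 'a input_symbol = LeftEnd | Letter 'a | RightEnd

datatype move = MoveLeft | Stay | MoveRight

fun offset :: "move \<Rightarrow> int" where
  "offset MoveLeft = -1"
| "offset Stay = 0"
| "offset MoveRight = 1"

(* A transition yields the new state, the work symbol written, the input head move
   and the work head move. *)
record ('q, 'g, 'a) ptm =
  start_state :: 'q
  accept_state :: 'q
  reject_state :: 'q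
  blank :: 'g
  trans :: "'q \<Rightarrow> 'a input_symbol \<Rightarrow> 'g \<Rightarrow> ('q \<times> 'g \<times> move \<times> move) pmf"

definition halting_states :: "('q, 'g, 'a) ptm \<Rightarrow> 'q set" where
  "halting_states M = {accept_state M, reject_state M}"

(* Finiteness of states and alphabets is expressed by class finite on the type parameters.
   Transitions out of the two halting states are never used and hence unconstrained. *)
definition is_ptm :: "('q::finite, 'g::finite, 'a::finite) ptm \<Rightarrow> bool" where
  "is_ptm M \<longleftrightarrow>
     accept_state M \<noteq> reject_state M \<and>
     (\<forall>q \<sigma> g. q \<notin> halting_states M \<longrightarrow>
        (\<forall>x. computable_real (pmf (trans M q \<sigma> g) x)) \<and>
        (\<forall>(q', g', d, e) \<in> set_pmf (trans M q \<sigma> g).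
           (\<sigma> = LeftEnd \<longrightarrow> d \<noteq> MoveLeft) \<and> (\<sigma> = RightEnd \<longrightarrow> d \<noteq> MoveRight)))"

definition input_tape :: "'a list \<Rightarrow> 'a input_symbol list" where
  "input_tape w = LeftEnd # map Letter w @ [RightEnd]"

(* The work tape is infinite in both directions. *)
record ('q, 'g) config =
  state :: 'q
  input_pos :: int
  work_tape :: "int \<Rightarrow> 'g"
  work_pos :: int

definition init_config :: "('q, 'g, 'a) ptm \<Rightarrow> ('q, 'g) config" where
  "init_config M =
     \<lparr>state = start_state M, input_pos = 0, work_tape = (\<lambda>_. blank M), work_pos = 0\<rparr>"

(* Halting configurations are absorbing. The input head position stays between 0 and
   length w + 1 by the endmarker condition in is_ptm. *)
definition step :: "('q, 'g, 'a) ptm \<Rightarrow> 'a list \<Rightarrow> ('q, 'g) config \<Rightarrow> ('q, 'g) config pmf" where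
  "step M w c =
     (if state c \<in> halting_states M then return_pmf c
      else map_pmf
        (\<lambda>(q', g', d, e).
           \<lparr>state = q', input_pos = input_pos c + offset d,
            work_tape = (work_tape c)(work_pos c := g'), work_pos = work_pos c + offset e\<rparr>)
        (trans M (state c) (input_tape w ! nat (input_pos c)) (work_tape c (work_pos c))))"

primrec run :: "('q, 'g, 'a) ptm \<Rightarrow> 'a list \<Rightarrow> nat \<Rightarrow> ('q, 'g) config pmf" where
  "run M w 0 = return_pmf (init_config M)"
| "run M w (Suc t) = bind_pmf (run M w t) (step M w)"

definition prob_in_by :: "('q, 'g, 'a) ptm \<Rightarrow> 'a list \<Rightarrow> 'q set \<Rightarrow> nat \<Rightarrow> real" where
  "prob_in_by M w S t = measure_pmf.prob (run M w t) {c. state c \<in> S}"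

(* For sets S of halting states, prob_in_by M w S t is the probability of having entered S
   within t steps; it increases with t, so its supremum is the probability of ever
   entering S. *)
definition accept_prob :: "('q, 'g, 'a) ptm \<Rightarrow> 'a list \<Rightarrow> real" where
  "accept_prob M w = (SUP t. prob_in_by M w {accept_state M} t)"

definition reject_prob :: "('q, 'g, 'a) ptm \<Rightarrow> 'a list \<Rightarrow> real" where
  "reject_prob M w = (SUP t. prob_in_by M w {reject_state M} t)"

definition halt_prob :: "('q, 'g, 'a) ptm \<Rightarrow> 'a list \<Rightarrow> real" where
  "halt_prob M w = (SUP t. prob_in_by M w (halting_states M) t)"

definition recognizes :: "('q, 'g, 'a) ptm \<Rightarrow> 'a list set \<Rightarrow> bool" where
  "recognizes M L \<longleftrightarrow>
     (\<exists>\<epsilon> < 1/2. (\<forall>w\<in>L. accept_prob M w \<ge> 1 - \<epsilon>) \<and> (\<forall>w. w \<notin> L \<longrightarrow> reject_prob M w \<ge> 1 - \<epsilon>))"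

(* Probability that the running time is exactly t steps. *)
definition halt_at_prob :: "('q, 'g, 'a) ptm \<Rightarrow> 'a list \<Rightarrow> nat \<Rightarrow> real" where
  "halt_at_prob M w t =
     (case t of
        0 \<Rightarrow> prob_in_by M w (halting_states M) 0
      | Suc t' \<Rightarrow> prob_in_by M w (halting_states M) (Suc t') - prob_in_by M w (halting_states M) t')"

(* Expected running time conditioned on halting; meaningful only if halt_prob M w > 0,
   which holds for every input of a machine that recognizes a language. *)
definition cond_expected_time :: "('q, 'g, 'a) ptm \<Rightarrow> 'a list \<Rightarrow> ennreal" where
  "cond_expected_time M w =
     (\<Sum>t. ennreal (real t * halt_at_prob M w t)) / ennreal (halt_prob M w)"

definition computation :: "('q, 'g, 'a) ptm \<Rightarrow> 'a list \<Rightarrow> ('q, 'g) config list \<Rightarrow> bool" where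
  "computation M w cs \<longleftrightarrow>
     cs \<noteq> [] \<and> hd cs = init_config M \<and>
     successively (\<lambda>c c'. c' \<in> set_pmf (step M w c)) cs"

(* Space is the number of work tape cells visited. Every computation path of positive
   probability counts, including prefixes of non-halting ones. *)
definition runs_within_space :: "('q, 'g, 'a) ptm \<Rightarrow> 'a list \<Rightarrow> real \<Rightarrow> bool" where
  "runs_within_space M w s \<longleftrightarrow>
     (\<forall>cs. computation M w cs \<longrightarrow> real (card (work_pos ` set cs)) \<le> s)"

end

(* Cut the input into w v and let the machine run on the tape w v. Its computation alternates
   between runs inside w and runs inside v, so it is governed by a finite Markov chain whose rows
   are the memory contents at the boundary; w enters only through the exit probabilities of its own
   segment. Absorption probabilities of a chain are robust: changing all entries by a factor at
   most exp x changes them by a factor at most exp (2 c x), where c is the number of rows, as one sees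
   by exchanging the rows one at a time. Hence it suffices to know the exit probabilities up to
   a factor 1 + O(1/c), and those below about 1/(c T) not at all, because the machine
   mostly halts within O(T) steps. This leaves (c log T)^O(1) values per entry, so at most
   (c log T)^O(c^2) classes of prefixes w such that prefixes in one class have the same extensions in L,
   as long as the lengths stay below n. With c = (log n)^o(1) and log log T < (log n)^b
   this is less than the square root of n, whereas a nonregular language needs more classes
   for infinitely many n. Runs that never leave a segment are cut off after
   O(T) steps and recorded as a separate outcome, so that no halting with probability one
   is required. *)

theory Submission
  imports Defs "HOL-Real_Asymp.Real_Asymp"
begin

section \<open>Absorption probabilities of finite chains\<close>

text \<open>Why relative errors: an additive error is multiplied by the number of rounds, about T.
  That is affordable below the truncation threshold, but additive rounding of that precision would
  need about T values per entry, where a logarithmic scale needs about log T. Relative errors in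
  turn survive only in sums with nonnegative coefficients, so the mass lost in a row has to be
  comparable as well. This is why truncated rows are renormalised and why being stuck counts as an
  outcome. One-sided estimates suffice. Suppose that \<open>w @ v\<close> is accepted,
  \<open>w' @ v\<close> is rejected, and \<open>w\<close> and \<open>w'\<close> lie in one class.
  Acceptance above 1/2 is carried over from the chain of \<open>w\<close> to that of
  \<open>w'\<close>, where it competes with rejection above 1/2. So a chain only has to overestimate
  the finite-time probabilities of the machine, and letting it run on beyond the time limit does no
  harm. Only the left runs are rounded; the runs inside \<open>v\<close> are common to both inputs
  and enter exactly. The passage to an automaton needs few classes for all large n. Slowness can
  therefore be concluded for infinitely many n.\<close>

definition chain_iter :: "'i set \<Rightarrow> ('i \<Rightarrow> 'i \<Rightarrow> real) \<Rightarrow> ('i \<Rightarrow> real) \<Rightarrow> nat \<Rightarrow> 'i \<Rightarrow> real" where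
  "chain_iter I p a m = ((\<lambda>x i. a i + (\<Sum>j\<in>I. p i j * x j)) ^^ m) (\<lambda>_. 0)"

lemma chain_iter_0 [simp]: "chain_iter I p a 0 i = 0"
  by (simp add: chain_iter_def)

lemma chain_iter_Suc [simp]:
  "chain_iter I p a (Suc m) i = a i + (\<Sum>j\<in>I. p i j * chain_iter I p a m j)"
  by (simp add: chain_iter_def)

text \<open>The least nonnegative solution of the absorption equations. It is taken as a limit of
  iterates because the linear system is singular as soon as some set of states loses no
  mass.\<close>

definition absorb :: "'i set \<Rightarrow> ('i \<Rightarrow> 'i \<Rightarrow> real) \<Rightarrow> ('i \<Rightarrow> real) \<Rightarrow> 'i \<Rightarrow> real" where
  "absorb I p a i = lim (\<lambda>m. chain_iter I p a m i)"

definition substochastic :: "'i set \<Rightarrow> ('i \<Rightarrow> 'i \<Rightarrow> real) \<Rightarrow> ('i \<Rightarrow> real) \<Rightarrow> bool" where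
  "substochastic I p a \<longleftrightarrow> finite I \<and>
     (\<forall>i\<in>I. 0 \<le> a i \<and> (\<forall>j\<in>I. 0 \<le> p i j) \<and> a i + (\<Sum>j\<in>I. p i j) \<le> 1)"

lemma chain_iter_nonneg:
  assumes "substochastic I p a" "i \<in> I"
  shows "0 \<le> chain_iter I p a m i"
  using assms(2)
proof (induction m arbitrary: i)
  case (Suc m)
  with assms(1) show ?case
    by (auto simp: substochastic_def intro!: add_nonneg_nonneg sum_nonneg)
qed simp

lemma chain_iter_le:
  assumes "substochastic I p a" and i: "i \<in> I"
    and y: "\<And>i. i \<in> I \<Longrightarrow> 0 \<le> y i" "\<And>i. i \<in> I \<Longrightarrow> a i + (\<Sum>j\<in>I. p i j * y j) \<le> y i"
  shows "chain_iter I p a m i \<le> y i"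
  using i
proof (induction m arbitrary: i)
  case (Suc m)
  have "a i + (\<Sum>j\<in>I. p i j * chain_iter I p a m j) \<le> a i + (\<Sum>j\<in>I. p i j * y j)"
    using Suc assms(1) by (intro add_left_mono sum_mono mult_left_mono) (auto simp: substochastic_def)
  also have "\<dots> \<le> y i" using y Suc by simp
  finally show ?case by simp
qed (use y in simp)

lemma chain_iter_le_1:
  assumes "substochastic I p a" "i \<in> I"
  shows "chain_iter I p a m i \<le> 1"
  by (rule chain_iter_le[OF assms, where y = "\<lambda>_. 1"]) (use assms in \<open>auto simp: substochastic_def\<close>)

lemma chain_iter_mono:
  assumes "substochastic I p a" "i \<in> I"
  shows "chain_iter I p a m i \<le> chain_iter I p a (Suc m) i"
  using assms(2)
proof (induction m arbitrary: i)
  case 0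
  then show ?case using chain_iter_nonneg[OF assms(1), of i "Suc 0"] by simp
next
  case (Suc m)
  have "a i + (\<Sum>j\<in>I. p i j * chain_iter I p a m j) \<le> a i + (\<Sum>j\<in>I. p i j * chain_iter I p a (Suc m) j)"
    using Suc assms(1) by (intro add_left_mono sum_mono mult_left_mono) (auto simp: substochastic_def)
  then show ?case by (metis chain_iter_Suc)
qed

lemma absorb_tendsto:
  assumes "substochastic I p a" "i \<in> I"
  shows "(\<lambda>m. chain_iter I p a m i) \<longlonglongrightarrow> absorb I p a i"
proof -
  have "incseq (\<lambda>m. chain_iter I p a m i)"
    using chain_iter_mono[OF assms] by (rule incseq_SucI)
  then obtain L where "(\<lambda>m. chain_iter I p a m i) \<longlonglongrightarrow> L"
    using incseq_convergent[where B = 1] chain_iter_le_1[OF assms] by metis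
  then show ?thesis by (simp add: absorb_def limI)
qed

lemma chain_iter_le_absorb:
  assumes "substochastic I p a" "i \<in> I"
  shows "chain_iter I p a m i \<le> absorb I p a i"
  by (rule incseq_le[OF incseq_SucI absorb_tendsto[OF assms]]) (rule chain_iter_mono[OF assms])

lemma absorb_bounds:
  assumes "substochastic I p a" "i \<in> I"
  shows "0 \<le> absorb I p a i" "absorb I p a i \<le> 1"
  using chain_iter_le_absorb[OF assms, of 0]
    LIMSEQ_le_const2[OF absorb_tendsto[OF assms]] chain_iter_le_1[OF assms] by auto

lemma absorb_fixpoint:
  assumes "substochastic I p a" "i \<in> I"
  shows "absorb I p a i = a i + (\<Sum>j\<in>I. p i j * absorb I p a j)"
proof -
  have "(\<lambda>m. chain_iter I p a (Suc m) i) \<longlonglongrightarrow> a i + (\<Sum>j\<in>I. p i j * absorb I p a j)"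
    unfolding chain_iter_Suc using absorb_tendsto[OF assms(1)]
    by (intro tendsto_intros) auto
  then show ?thesis
    using LIMSEQ_unique LIMSEQ_Suc[OF absorb_tendsto[OF assms]] by blast
qed

text \<open>Iterates started at 0 stay below every nonnegative supersolution. This decides the cases
  in which the equations alone leave a choice.\<close>

lemma absorb_least:
  assumes "substochastic I p a" "i \<in> I"
    and "\<And>i. i \<in> I \<Longrightarrow> 0 \<le> y i" "\<And>i. i \<in> I \<Longrightarrow> a i + (\<Sum>j\<in>I. p i j * y j) \<le> y i"
  shows "absorb I p a i \<le> y i"
  using LIMSEQ_le_const2[OF absorb_tendsto[OF assms(1,2)]] chain_iter_le[OF assms] by auto

text \<open>The iterates are linear in the target vector, so the two add up to the iterate for the
  joint target, which is at most 1.\<close>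

lemma absorb_disjoint_targets:
  assumes ab: "substochastic I p (\<lambda>i. a i + b i)"
    and a: "\<And>i. i \<in> I \<Longrightarrow> 0 \<le> a i" and b: "\<And>i. i \<in> I \<Longrightarrow> 0 \<le> b i" and i: "i \<in> I"
  shows "absorb I p a i + absorb I p b i \<le> 1"
proof -
  have sa: "substochastic I p a" and sb: "substochastic I p b"
    using ab a b by (fastforce simp: substochastic_def)+
  have "chain_iter I p a m i + chain_iter I p b m i \<le> 1" for m
  proof -
    have "chain_iter I p a m i + chain_iter I p b m i = chain_iter I p (\<lambda>i. a i + b i) m i" for i
    proof (induction m arbitrary: i)
      case (Suc m)
      then show ?case
        by (simp add: algebra_simps sum.distrib flip: Suc.IH)
    qed simp
    then show ?thesis using chain_iter_le_1[OF ab i] by simp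
  qed
  then show ?thesis
    using LIMSEQ_le_const2[OF tendsto_add[OF absorb_tendsto[OF sa i] absorb_tendsto[OF sb i]]]
    by auto
qed

text \<open>Conditioning on the first visit to the state k: neither of the two chains on the right
  depends on row k of the original chain.\<close>

lemma absorb_first_visit:
  assumes s: "substochastic I p a" and k: "k \<in> I" and i: "i \<in> I"
  shows "absorb I p a i = absorb I (p(k := \<lambda>_. 0)) (a(k := 0)) i +
    absorb I (p(k := \<lambda>_. 0)) (\<lambda>i. of_bool (i = k)) i * absorb I p a k"
    (is "_ = ?h i + ?g i * ?x k")
proof -
  let ?q = "p(k := \<lambda>_. 0)"
  have sh: "substochastic I ?q (a(k := 0))" 
    using s by (auto simp: substochastic_def)
  have sg: "substochastic I ?q (\<lambda>i. of_bool (i = k))" 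
  proof -
    have "(\<Sum>j\<in>I. p i j) \<le> 1" if "i \<in> I" for i
      using s that unfolding substochastic_def by (smt (verit))
    then show ?thesis using s by (auto simp: substochastic_def)
  qed
  have hk: "?h k = 0" "?g k = 1"
    using absorb_fixpoint[OF sh k] absorb_fixpoint[OF sg k] by (simp_all del: fun_upd_apply add: fun_upd_same)
  have x0: "0 \<le> ?x i" if "i \<in> I" for i using absorb_bounds[OF s that] by simp
  have le: "?h i + ?g i * ?x k \<le> ?x i" if "i \<in> I" for i
  proof -
    have it: "chain_iter I ?q (a(k := 0)) m i + chain_iter I ?q (\<lambda>i. of_bool (i = k)) m i * ?x k \<le> ?x i"
      if "i \<in> I" for m i
      using that
    proof (induction m arbitrary: i)
      case 0
      then show ?case using x0 by simp
    next
      case (Suc m)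
      show ?case
      proof (cases "i = k")
        case False
        let ?c = "\<lambda>j. chain_iter I ?q (a(k := 0)) m j + chain_iter I ?q (\<lambda>i. of_bool (i = k)) m j * ?x k"
        have "(\<Sum>j\<in>I. p i j * ?c j) \<le> (\<Sum>j\<in>I. p i j * ?x j)"
          using Suc.prems s by (intro sum_mono mult_left_mono Suc.IH) (auto simp: substochastic_def)
        then show ?thesis using False absorb_fixpoint[OF s Suc.prems]
          by (simp del: fun_upd_apply add: fun_upd_other algebra_simps sum.distrib sum_distrib_left sum_distrib_right)
      qed simp
    qed
    show ?thesis
      using LIMSEQ_le_const2[OF tendsto_add[OF absorb_tendsto[OF sh that]
          tendsto_mult_right[OF absorb_tendsto[OF sg that]]]] it[OF that] by blast
  qed
  \<comment> \<open>This direction comes from minimality. In row \<open>k\<close> the supersolution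
    inequality is an instance of the opposite direction \<open>le\<close>, because the right-hand
    side takes the value \<open>?x k\<close> there.\<close>
  have "?x i \<le> ?h i + ?g i * ?x k"
  proof (rule absorb_least[OF s i])
    fix i assume i: "i \<in> I"
    show "0 \<le> ?h i + ?g i * ?x k"
      using absorb_bounds(1)[OF sh i] absorb_bounds(1)[OF sg i] x0[OF k]
      by (intro add_nonneg_nonneg mult_nonneg_nonneg)
    show "a i + (\<Sum>j\<in>I. p i j * (?h j + ?g j * ?x k)) \<le> ?h i + ?g i * ?x k"
    proof (cases "i = k")
      case True
      have "(\<Sum>j\<in>I. p i j * (?h j + ?g j * ?x k)) \<le> (\<Sum>j\<in>I. p i j * ?x j)"
        using le s i by (intro sum_mono mult_left_mono) (auto simp: substochastic_def)
      then show ?thesis using absorb_fixpoint[OF s i] True hk by (simp del: fun_upd_apply)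
    next
      case False
      then show ?thesis
        using absorb_fixpoint[OF sh i] absorb_fixpoint[OF sg i]
        by (simp del: fun_upd_apply add: fun_upd_other algebra_simps sum.distrib sum_distrib_left sum_distrib_right)
    qed
  qed
  then show ?thesis by (rule antisym[OF _ le[OF i]])
qed

text \<open>The last clause treats the lost mass of the row as one more entry. One direction is
  demanded, since it serves only to bound the denominator of the second row from above.\<close>

definition row_close :: "real \<Rightarrow> 'i set \<Rightarrow> ('i \<Rightarrow> real) \<Rightarrow> real \<Rightarrow> ('i \<Rightarrow> real) \<Rightarrow> real \<Rightarrow> bool" where
  "row_close \<alpha> I p a p' a' \<longleftrightarrow> a \<le> \<alpha> * a' \<and> a' \<le> \<alpha> * a \<and>
     (\<forall>j\<in>I. p j \<le> \<alpha> * p' j \<and> p' j \<le> \<alpha> * p j) \<and>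
     1 - a' - (\<Sum>j\<in>I. p' j) \<le> \<alpha> * (1 - a - (\<Sum>j\<in>I. p j))"

text \<open>From row \<open>k\<close> the absorption probability is a quotient: the probability
  \<open>H\<close> of absorption before a return to \<open>k\<close>, over the probability
  \<open>D\<close> of no return. Both are nonnegative combinations of the entries of row
  \<open>k\<close> and its loss, with coefficients independent of that row. Each changes by a factor
  at most \<alpha>, which gives the square.\<close>

lemma absorb_swap_row:
  assumes s: "substochastic I p a" and s': "substochastic I p' a'" and k: "k \<in> I" and i: "i \<in> I"
    and \<alpha>: "1 \<le> \<alpha>"
    and eq: "p(k := \<lambda>_. 0) = p'(k := \<lambda>_. 0)" "a(k := 0) = a'(k := 0)"
    and cl: "row_close \<alpha> I (p k) (a k) (p' k) (a' k)"
  shows "absorb I p a i \<le> \<alpha>\<^sup>2 * absorb I p' a' i"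
proof -
  let ?q = "p(k := \<lambda>_. 0)"
  define h where "h = absorb I ?q (a(k := 0))"
  define g where "g = absorb I ?q (\<lambda>i. of_bool (i = k))"
  let ?x = "absorb I p a" and ?y = "absorb I p' a'"
  have sh: "substochastic I ?q (a(k := 0))" 
    using s by (auto simp: substochastic_def)
  have shg: "substochastic I ?q (\<lambda>i. (a(k := 0)) i + of_bool (i = k))"
    using s by (auto simp: substochastic_def)
  have sg: "substochastic I ?q (\<lambda>i. of_bool (i = k))" 
    using s shg by (fastforce simp: substochastic_def)
  have hk: "h k = 0" "g k = 1"
    using absorb_fixpoint[OF sh k] absorb_fixpoint[OF sg k] by (simp_all add: h_def g_def)
  have h0: "0 \<le> h j" and g0: "0 \<le> g j" if "j \<in> I" for j
    using absorb_bounds[OF sh that] absorb_bounds[OF sg that] by (auto simp: h_def g_def)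
  have hg: "h j + g j \<le> 1" if "j \<in> I" for j
    unfolding h_def g_def using s that
    by (intro absorb_disjoint_targets[OF shg]) (auto simp: substochastic_def)
  have x: "?x j = h j + g j * ?x k" and y: "?y j = h j + g j * ?y k" if "j \<in> I" for j
    using absorb_first_visit[OF s k that] absorb_first_visit[OF s' k that]
    by (simp_all add: h_def g_def eq)
  have pos: "0 \<le> p k j" "0 \<le> p' k j" if "j \<in> I" for j
    using s s' k that by (auto simp: substochastic_def)
  have apos: "0 \<le> a k" "0 \<le> a' k" using s s' k by (auto simp: substochastic_def)
  define H where "H = a k + (\<Sum>j\<in>I. p k j * h j)"
  define H' where "H' = a' k + (\<Sum>j\<in>I. p' k j * h j)"
  define D where "D = 1 - (\<Sum>j\<in>I. p k j * g j)"
  define D' where "D' = 1 - (\<Sum>j\<in>I. p' k j * g j)"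
  \<comment> \<open>As a difference \<open>D\<close> would not inherit relative closeness. Rewritten
    this way it is a sum of nonnegative terms, because \<open>h + g\<close> is at most 1.\<close>
  have D: "D = H + (1 - a k - (\<Sum>j\<in>I. p k j)) + (\<Sum>j\<in>I. p k j * (1 - h j - g j))"
    and D': "D' = H' + (1 - a' k - (\<Sum>j\<in>I. p' k j)) + (\<Sum>j\<in>I. p' k j * (1 - h j - g j))"
    by (simp_all add: D_def H_def D'_def H'_def algebra_simps sum.distrib sum_subtractf)
  have xk: "D * ?x k = H"
    using absorb_fixpoint[OF s k] x
    by (simp add: D_def H_def algebra_simps sum.distrib sum_distrib_left sum_distrib_right cong: sum.cong)
  have yk: "D' * ?y k = H'"
    using absorb_fixpoint[OF s' k] y
    by (simp add: D'_def H'_def algebra_simps sum.distrib sum_distrib_left sum_distrib_right cong: sum.cong)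
  have "0 \<le> (\<Sum>j\<in>I. p k j * (1 - h j - g j))"
    using hg pos by (intro sum_nonneg mult_nonneg_nonneg) (auto simp: algebra_simps)
  then have HD: "H \<le> D" unfolding D using s k by (fastforce simp: substochastic_def)
  have H0: "0 \<le> H" using apos pos h0 by (auto simp: H_def intro!: add_nonneg_nonneg sum_nonneg)
  have HH: "H \<le> \<alpha> * H'" "H' \<le> \<alpha> * H"
  proof -
    have "(\<Sum>j\<in>I. p k j * h j) \<le> (\<Sum>j\<in>I. \<alpha> * p' k j * h j)"
         "(\<Sum>j\<in>I. p' k j * h j) \<le> (\<Sum>j\<in>I. \<alpha> * p k j * h j)"
      using cl h0 by (auto simp: row_close_def intro!: sum_mono mult_right_mono)
    then show "H \<le> \<alpha> * H'" "H' \<le> \<alpha> * H"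
      using cl by (auto simp: row_close_def H_def H'_def algebra_simps sum_distrib_left)
  qed
  have DD: "D' \<le> \<alpha> * D"
  proof -
    have "(\<Sum>j\<in>I. p' k j * (1 - h j - g j)) \<le> (\<Sum>j\<in>I. \<alpha> * p k j * (1 - h j - g j))"
    proof (intro sum_mono mult_right_mono)
      fix j assume "j \<in> I"
      then show "p' k j \<le> \<alpha> * p k j" "0 \<le> 1 - h j - g j"
        using cl hg[of j] by (auto simp: row_close_def)
    qed
    also have "\<dots> = \<alpha> * (\<Sum>j\<in>I. p k j * (1 - h j - g j))"
      by (simp add: sum_distrib_left mult.assoc)
    finally show ?thesis unfolding D D' using cl HH(2)
      by (simp add: row_close_def distrib_left)
  qed
  have y0: "0 \<le> ?y k" using absorb_bounds[OF s' k] by simp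
  have "?x k \<le> \<alpha>\<^sup>2 * ?y k"
  proof (cases "D = 0")
    case True
    with HD H0 have "H = 0" by simp
    \<comment> \<open>Here the chain returns to \<open>k\<close> with probability one, and the
      quotient is 0/0. Minimality picks the value 0, since \<open>h\<close> is a supersolution that
      vanishes at \<open>k\<close>.\<close>
    have "?x k \<le> h k"
    proof (rule absorb_least[OF s k])
      fix i assume i: "i \<in> I"
      show "0 \<le> h i" using h0[OF i] .
      show "a i + (\<Sum>j\<in>I. p i j * h j) \<le> h i"
      proof (cases "i = k")
        case True
        then show ?thesis using \<open>H = 0\<close> hk by (simp add: H_def)
      next
        case False
        then show ?thesis using absorb_fixpoint[OF sh i] by (simp add: h_def)
      qed
    qed
    then show ?thesis using y0 hk by (smt (verit) zero_le_power2 mult_nonneg_nonneg)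
  next
    case False
    then have "D > 0" using HD H0 by simp
    have "D * ?x k \<le> \<alpha> * (D' * ?y k)" using xk yk HH by simp
    also have "\<dots> \<le> \<alpha> * ((\<alpha> * D) * ?y k)"
      using \<alpha> y0 DD by (intro mult_left_mono mult_right_mono) auto
    finally have "D * ?x k \<le> D * (\<alpha>\<^sup>2 * ?y k)" by (simp add: power2_eq_square mult_ac)
    then show ?thesis using \<open>D > 0\<close> by simp
  qed
  then have "?x i \<le> h i + g i * (\<alpha>\<^sup>2 * ?y k)"
    unfolding x[OF i] using g0[OF i] by (simp add: mult_left_mono)
  also have "\<dots> \<le> \<alpha>\<^sup>2 * h i + \<alpha>\<^sup>2 * (g i * ?y k)"
  proof -
    have "1 * h i \<le> \<alpha>\<^sup>2 * h i" using h0[OF i] \<alpha> by (intro mult_right_mono) (auto simp: one_le_power)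
    then show ?thesis by (simp add: mult_ac)
  qed
  also have "\<dots> = \<alpha>\<^sup>2 * ?y i" unfolding y[OF i] by (simp add: algebra_simps)
  finally show ?thesis .
qed

lemma absorb_close:
  assumes s: "substochastic I p a" and s': "substochastic I p' a'" and i: "i \<in> I"
    and \<alpha>: "1 \<le> \<alpha>"
    and cl: "\<And>k. k \<in> I \<Longrightarrow> row_close \<alpha> I (p k) (a k) (p' k) (a' k)"
  shows "absorb I p a i \<le> \<alpha> ^ (2 * card I) * absorb I p' a' i"
proof -
  \<comment> \<open>Hybrids in which the rows of \<open>J\<close> are already exchanged. Being
    substochastic is a condition on single rows, so every hybrid inherits it.\<close>
  define mp where "mp J = (\<lambda>i. if i \<in> J then p' i else p i)" for J
  define ma where "ma J = (\<lambda>i. if i \<in> J then a' i else a i)" for J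
  have sub: "substochastic I (mp J) (ma J)" for J
    using s s' by (auto simp: substochastic_def mp_def ma_def)
  have fin: "finite I" using s by (simp add: substochastic_def)
  have "J \<subseteq> I \<Longrightarrow> absorb I p a i \<le> \<alpha> ^ (2 * card J) * absorb I (mp J) (ma J) i" if "finite J" for J
    using that
  proof (induction J rule: finite_induct)
    case empty
    then show ?case by (simp add: mp_def ma_def)
  next
    case (insert k J)
    have "absorb I p a i \<le> \<alpha> ^ (2 * card J) * absorb I (mp J) (ma J) i" using insert by simp
    also have "absorb I (mp J) (ma J) i \<le> \<alpha>\<^sup>2 * absorb I (mp (insert k J)) (ma (insert k J)) i"
    proof (rule absorb_swap_row[OF sub sub, where k = k])
      show "(mp J)(k := \<lambda>_. 0) = (mp (insert k J))(k := \<lambda>_. 0)"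
        "(ma J)(k := 0) = (ma (insert k J))(k := 0)"
        "row_close \<alpha> I (mp J k) (ma J k) (mp (insert k J) k) (ma (insert k J) k)"
        using insert cl[of k] by (auto simp: mp_def ma_def)
    qed (use insert i \<alpha> in auto)
    finally show ?case using insert \<alpha>
      by (simp add: power_add mult_left_mono power2_eq_square mult_ac)
  qed
  from this[OF fin] have "absorb I p a i \<le> \<alpha> ^ (2 * card I) * absorb I (mp I) (ma I) i" by simp
  moreover have "absorb I (mp I) (ma I) i = absorb I p' a' i"
  proof -
    have "chain_iter I (mp I) (ma I) m i = chain_iter I p' a' m i" if "i \<in> I" for m i
      using that by (induction m arbitrary: i) (auto simp: mp_def ma_def)
    then show ?thesis using i by (simp add: absorb_def)
  qed
  ultimately show ?thesis by simp
qed

section \<open>Dropping small probabilities and renormalising\<close>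

section \<open>Truncated outcome distributions\<close>

text \<open>Without the division the dropped mass would count as lost in the row, and the dropped
  masses of two rows need not be relatively close. The bound on \<open>\<mu> * card O'\<close>
  assumed below leaves at least half of the mass, so the divisor is not 0.\<close>

definition trunc :: "real \<Rightarrow> 'o set \<Rightarrow> ('o \<Rightarrow> real) \<Rightarrow> 'o \<Rightarrow> real" where
  "trunc \<mu> O' P o' = (if P o' < \<mu> then 0 else P o') / (\<Sum>o''\<in>O'. if P o'' < \<mu> then 0 else P o'')"

definition distribution_on :: "'o set \<Rightarrow> ('o \<Rightarrow> real) \<Rightarrow> bool" where
  "distribution_on O' P \<longleftrightarrow> finite O' \<and> (\<forall>o'\<in>O'. 0 \<le> P o') \<and> (\<Sum>o'\<in>O'. P o') = 1"

context
  fixes \<mu> :: real and O' :: "'o set"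
  assumes \<mu>: "0 < \<mu>" "\<mu> * card O' \<le> 1 / 2"
begin

lemma trunc_mass_pos:
  assumes "distribution_on O' P"
  shows "0 < (\<Sum>o'\<in>O'. if P o' < \<mu> then 0 else P o')" "(\<Sum>o'\<in>O'. if P o' < \<mu> then 0 else P o') \<le> 1"
proof -
  have "1 = (\<Sum>o'\<in>O'. P o')" using assms by (simp add: distribution_on_def)
  also have "\<dots> \<le> (\<Sum>o'\<in>O'. (if P o' < \<mu> then 0 else P o') + \<mu>)"
    using \<mu> by (intro sum_mono) auto
  also have "\<dots> = (\<Sum>o'\<in>O'. if P o' < \<mu> then 0 else P o') + \<mu> * card O'"
    by (simp add: sum.distrib mult.commute)
  finally show "0 < (\<Sum>o'\<in>O'. if P o' < \<mu> then 0 else P o')" using \<mu> by linarith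
  have "(\<Sum>o'\<in>O'. if P o' < \<mu> then 0 else P o') \<le> (\<Sum>o'\<in>O'. P o')"
    using assms by (intro sum_mono) (auto simp: distribution_on_def)
  then show "(\<Sum>o'\<in>O'. if P o' < \<mu> then 0 else P o') \<le> 1" 
    using assms by (simp add: distribution_on_def)
qed

lemma distribution_trunc:
  assumes "distribution_on O' P"
  shows "distribution_on O' (trunc \<mu> O' P)"
  using assms trunc_mass_pos[OF assms]
  by (auto simp: distribution_on_def trunc_def sum_divide_distrib[symmetric] intro!: divide_nonneg_nonneg)

text \<open>The divisor is at most 1, so surviving entries can only grow.\<close>

lemma le_trunc:
  assumes "distribution_on O' P" "o' \<in> O'" "\<mu> \<le> P o'"
  shows "P o' \<le> trunc \<mu> O' P o'"
proof -
  have "P o' * (\<Sum>o'\<in>O'. if P o' < \<mu> then 0 else P o') \<le> P o' * 1"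
    using trunc_mass_pos[OF assms(1)] assms by (intro mult_left_mono) (auto simp: distribution_on_def)
  then show ?thesis
    using assms(3) trunc_mass_pos(1)[OF assms(1)] by (simp add: trunc_def pos_le_divide_eq)
qed

text \<open>One factor \<beta> comes from the entry and one from the normalising sum.\<close>

lemma trunc_close:
  assumes P: "distribution_on O' P" and P': "distribution_on O' P'" and \<beta>: "1 \<le> \<beta>"
    and cl: "\<And>o'. o' \<in> O' \<Longrightarrow> P o' < \<mu> \<longleftrightarrow> P' o' < \<mu>"
      "\<And>o'. o' \<in> O' \<Longrightarrow> \<mu> \<le> P o' \<Longrightarrow> P o' \<le> \<beta> * P' o' \<and> P' o' \<le> \<beta> * P o'"
    and o': "o' \<in> O'"
  shows "trunc \<mu> O' P o' \<le> \<beta>\<^sup>2 * trunc \<mu> O' P' o'"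
proof -
  let ?f = "\<lambda>P o'. if P o' < \<mu> then 0 else P o' :: real"
  let ?s = "\<lambda>P. \<Sum>o'\<in>O'. ?f P o'"
  have "?s P' \<le> (\<Sum>o'\<in>O'. \<beta> * ?f P o')"
  proof (rule sum_mono)
    fix o' assume "o' \<in> O'"
    then show "?f P' o' \<le> \<beta> * ?f P o'" using cl[of o'] by (auto simp: not_less)
  qed
  then have s: "?s P' \<le> \<beta> * ?s P" by (simp add: sum_distrib_left)
  have pos: "0 < ?s P" "0 < ?s P'" using trunc_mass_pos P P' by auto
  have f: "?f P o' \<le> \<beta> * ?f P' o'" using cl[OF o'] by (auto simp: not_less)
  have f0: "0 \<le> ?f P' o'" using P' o' by (auto simp: distribution_on_def)
  have "?f P o' * ?s P' \<le> (\<beta> * ?f P' o') * (\<beta> * ?s P)"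
    using f s \<beta> pos f0 by (intro mult_mono) auto
  then show ?thesis using pos
    by (simp only: trunc_def times_divide_eq_right) (simp add: field_simps power2_eq_square)
qed

end

section \<open>Chains whose rounds pass through intermediate outcomes\<close>

text \<open>An outcome of a round is either terminal, rewarded by A, or leads to a next row via Q.\<close>

definition round_reward :: "'o set \<Rightarrow> ('i \<Rightarrow> 'o \<Rightarrow> real) \<Rightarrow> ('o \<Rightarrow> real) \<Rightarrow> 'i \<Rightarrow> real" where
  "round_reward O' P A i = (\<Sum>o'\<in>O'. P i o' * A o')"

definition round_kernel :: "'o set \<Rightarrow> ('i \<Rightarrow> 'o \<Rightarrow> real) \<Rightarrow> ('o \<Rightarrow> 'i \<Rightarrow> real) \<Rightarrow> 'i \<Rightarrow> 'i \<Rightarrow> real" where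
  "round_kernel O' P Q i j = (\<Sum>o'\<in>O'. P i o' * Q o' j)"

definition outcome_ok :: "'i set \<Rightarrow> 'o set \<Rightarrow> ('o \<Rightarrow> 'i \<Rightarrow> real) \<Rightarrow> ('o \<Rightarrow> real) \<Rightarrow> bool" where
  "outcome_ok I O' Q A \<longleftrightarrow> finite I \<and>
     (\<forall>o'\<in>O'. 0 \<le> A o' \<and> (\<forall>j\<in>I. 0 \<le> Q o' j) \<and> A o' + (\<Sum>j\<in>I. Q o' j) \<le> 1)"

lemma round_step:
  "round_reward O' P A i + (\<Sum>j\<in>I. round_kernel O' P Q i j * x j) =
    (\<Sum>o'\<in>O'. P i o' * (A o' + (\<Sum>j\<in>I. Q o' j * x j)))"
proof -
  have "(\<Sum>j\<in>I. \<Sum>o'\<in>O'. P i o' * Q o' j * x j) = (\<Sum>o'\<in>O'. \<Sum>j\<in>I. P i o' * Q o' j * x j)"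
    by (rule sum.swap)
  then show ?thesis
    by (simp add: round_reward_def round_kernel_def distrib_left sum.distrib sum_distrib_left
        sum_distrib_right mult.assoc)
qed

text \<open>The loss of a composed row is again a nonnegative combination of the outcome
  probabilities, so it inherits relative closeness from them. This rests on the outcome
  probabilities summing to exactly 1.\<close>

lemma round_defect:
  assumes "distribution_on O' (P i)"
  shows "1 - round_reward O' P A i - (\<Sum>j\<in>I. round_kernel O' P Q i j) =
    (\<Sum>o'\<in>O'. P i o' * (1 - A o' - (\<Sum>j\<in>I. Q o' j)))"
proof -
  have "1 = (\<Sum>o'\<in>O'. P i o')" using assms by (simp add: distribution_on_def)
  then show ?thesis using round_step[of O' P A i Q "\<lambda>_. 1" I]
    by (simp add: algebra_simps sum.distrib sum_subtractf)
qed

lemma substochastic_round: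
  assumes "outcome_ok I O' Q A" "\<And>i. i \<in> I \<Longrightarrow> distribution_on O' (P i)"
  shows "substochastic I (round_kernel O' P Q) (round_reward O' P A)"
proof -
  have "0 \<le> 1 - round_reward O' P A i - (\<Sum>j\<in>I. round_kernel O' P Q i j)" if "i \<in> I" for i
    unfolding round_defect[of O' P i A Q I, OF assms(2)[OF that]] using assms that
    by (intro sum_nonneg mult_nonneg_nonneg) (auto simp: outcome_ok_def distribution_on_def algebra_simps)
  then show ?thesis
    using assms by (auto simp: substochastic_def outcome_ok_def distribution_on_def
        round_reward_def round_kernel_def algebra_simps intro!: sum_nonneg)
qed

lemma row_close_round:
  assumes ok: "outcome_ok I O' Q A"
    and P: "distribution_on O' (P i)" "distribution_on O' (P' i)"
    and cl: "\<And>o'. o' \<in> O' \<Longrightarrow> P i o' \<le> \<alpha> * P' i o'" "\<And>o'. o' \<in> O' \<Longrightarrow> P' i o' \<le> \<alpha> * P i o'"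
  shows "row_close \<alpha> I (round_kernel O' P Q i) (round_reward O' P A i)
    (round_kernel O' P' Q i) (round_reward O' P' A i)"
proof -
  have le: "(\<Sum>o'\<in>O'. p o' * f o') \<le> \<alpha> * (\<Sum>o'\<in>O'. p' o' * f o')"
    if "\<And>o'. o' \<in> O' \<Longrightarrow> p o' \<le> \<alpha> * p' o'" "\<And>o'. o' \<in> O' \<Longrightarrow> 0 \<le> f o'" 
    for p p' f :: "'b \<Rightarrow> real"
  proof -
    have "(\<Sum>o'\<in>O'. p o' * f o') \<le> (\<Sum>o'\<in>O'. \<alpha> * p' o' * f o')"
      using that by (intro sum_mono mult_right_mono) auto
    then show ?thesis by (simp add: sum_distrib_left mult.assoc)
  qed
  show ?thesis
    unfolding row_close_def round_defect[where P = P, OF P(1)] round_defect[where P = P', OF P(2)]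
    unfolding round_kernel_def round_reward_def
    by (intro conjI ballI le cl) (use ok in \<open>auto simp: outcome_ok_def algebra_simps\<close>)
qed

text \<open>The value after an outcome is at most 1, so dropping an outcome costs at most \<mu>, and
  surviving entries only grow. These costs add up over the rounds.\<close>

lemma chain_iter_trunc:
  fixes \<mu> :: real
  assumes ok: "outcome_ok I O' Q A" and P: "\<And>i. i \<in> I \<Longrightarrow> distribution_on O' (P i)"
    and \<mu>: "0 < \<mu>" "\<mu> * card O' \<le> 1 / 2" and i: "i \<in> I"
  shows "chain_iter I (round_kernel O' P Q) (round_reward O' P A) m i \<le>
    chain_iter I (round_kernel O' (\<lambda>i. trunc \<mu> O' (P i)) Q)
      (round_reward O' (\<lambda>i. trunc \<mu> O' (P i)) A) m i + m * card O' * \<mu>"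
    (is "?x m i \<le> ?y m i + _")
  using i
proof (induction m arbitrary: i)
  case (Suc m)
  let ?P = "\<lambda>i. trunc \<mu> O' (P i)"
  have fin: "finite O'" using P[OF Suc.prems] by (simp add: distribution_on_def)
  have P': "distribution_on O' (?P i)" if "i \<in> I" for i
    using distribution_trunc[OF \<mu>] P that by blast
  have sx: "substochastic I (round_kernel O' P Q) (round_reward O' P A)"
    by (rule substochastic_round[OF ok P])
  have sy: "substochastic I (round_kernel O' ?P Q) (round_reward O' ?P A)"
    by (rule substochastic_round[OF ok P'])
  define F where "F x o' = A o' + (\<Sum>j\<in>I. Q o' j * x j)" for x :: "'a \<Rightarrow> real" and o'
  let ?e = "m * card O' * \<mu>"
  have F0: "0 \<le> F (?y m) o'" if "o' \<in> O'" for o'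
    using ok chain_iter_nonneg[OF sy] that unfolding F_def outcome_ok_def
    by (intro add_nonneg_nonneg sum_nonneg mult_nonneg_nonneg) auto
  have F1: "F (?x m) o' \<le> 1" if "o' \<in> O'" for o'
  proof -
    have "F (?x m) o' \<le> A o' + (\<Sum>j\<in>I. Q o' j * 1)" unfolding F_def
      using ok chain_iter_le_1[OF sx] that unfolding outcome_ok_def
      by (intro add_left_mono sum_mono mult_left_mono) auto
    then show ?thesis using ok that by (fastforce simp: outcome_ok_def)
  qed
  have FF: "F (?x m) o' \<le> F (?y m) o' + ?e" if "o' \<in> O'" for o'
  proof -
    have Q: "0 \<le> Q o' j" if "j \<in> I" for j using ok that \<open>o' \<in> O'\<close> by (auto simp: outcome_ok_def)
    have "A o' + (\<Sum>j\<in>I. Q o' j) \<le> 1" "0 \<le> A o'" using ok that by (auto simp: outcome_ok_def)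
    then have Q1: "(\<Sum>j\<in>I. Q o' j) \<le> 1" by linarith
    have "F (?x m) o' \<le> A o' + (\<Sum>j\<in>I. Q o' j * (?y m j + ?e))" unfolding F_def
      using Suc.IH Q by (intro add_left_mono sum_mono mult_left_mono) auto
    also have "\<dots> = F (?y m) o' + (\<Sum>j\<in>I. Q o' j) * ?e"
      by (simp add: F_def distrib_left sum.distrib sum_distrib_right)
    also have "(\<Sum>j\<in>I. Q o' j) * ?e \<le> 1 * ?e" using Q1 \<mu> by (intro mult_right_mono) auto
    finally show ?thesis by simp
  qed
  have "P i o' * F (?x m) o' \<le> ?P i o' * F (?y m) o' + P i o' * ?e + \<mu>" if "o' \<in> O'" for o'
  proof (cases "P i o' < \<mu>")
    case True
    have p0: "0 \<le> P i o'" using P[OF Suc.prems] that by (auto simp: distribution_on_def)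
    have "P i o' * F (?x m) o' \<le> P i o' * 1" using F1[OF that] p0 by (intro mult_left_mono) auto
    moreover have "0 \<le> ?P i o' * F (?y m) o'"
      using P'[OF Suc.prems] F0 that by (auto simp: distribution_on_def)
    moreover have "0 \<le> P i o' * ?e" using p0 \<mu> by auto
    ultimately show ?thesis using True by linarith
  next
    case False
    have "P i o' * F (?x m) o' \<le> P i o' * (F (?y m) o' + ?e)"
      using FF[OF that] False \<mu> by (intro mult_left_mono) auto
    also have "\<dots> \<le> ?P i o' * F (?y m) o' + P i o' * ?e"
      using le_trunc[OF \<mu> P[OF Suc.prems] that] False F0[OF that]
      by (auto simp: distrib_left intro: mult_right_mono)
    finally show ?thesis using \<mu> by simp
  qed
  then have "(\<Sum>o'\<in>O'. P i o' * F (?x m) o') \<le> (\<Sum>o'\<in>O'. ?P i o' * F (?y m) o' + P i o' * ?e + \<mu>)"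
    by (rule sum_mono)
  also have "\<dots> = (\<Sum>o'\<in>O'. ?P i o' * F (?y m) o') + ?e + card O' * \<mu>"
    using P[OF Suc.prems] by (simp add: sum.distrib distribution_on_def flip: sum_distrib_right)
  finally show ?case by (simp add: round_step F_def algebra_simps)
qed simp

text \<open>Only the entries of size at least \<mu> have to be comparable: truncation removes the others,
  at a cost of at most \<mu> per outcome and round.\<close>

lemma close_systems_agree:
  fixes \<mu> :: real
  assumes ok: "outcome_ok I O' Q (\<lambda>o'. A o' + R o')"
    and A: "\<And>o'. o' \<in> O' \<Longrightarrow> 0 \<le> A o'" and R: "\<And>o'. o' \<in> O' \<Longrightarrow> 0 \<le> R o'"
    and P: "\<And>i. i \<in> I \<Longrightarrow> distribution_on O' (P i)" and P': "\<And>i. i \<in> I \<Longrightarrow> distribution_on O' (P' i)"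
    and \<mu>: "0 < \<mu>" "\<mu> * card O' \<le> 1 / 2" and i: "i \<in> I" and \<beta>: "1 \<le> \<beta>"
    and cl: "\<And>i o'. i \<in> I \<Longrightarrow> o' \<in> O' \<Longrightarrow> P i o' < \<mu> \<longleftrightarrow> P' i o' < \<mu>"
      "\<And>i o'. i \<in> I \<Longrightarrow> o' \<in> O' \<Longrightarrow> \<mu> \<le> P i o' \<Longrightarrow> P i o' \<le> \<beta> * P' i o' \<and> P' i o' \<le> \<beta> * P i o'"
    and \<delta>: "\<beta> ^ (4 * card I) \<le> exp \<delta>" "0 < \<delta>" "\<delta> < 1"
    and acc: "1 / 2 + \<delta> + m * card O' * \<mu> \<le>
      chain_iter I (round_kernel O' P Q) (round_reward O' P A) m i"
    and rej: "1 / 2 + \<delta> + m * card O' * \<mu> \<le>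
      chain_iter I (round_kernel O' P' Q) (round_reward O' P' R) m i"
  shows False
proof -
  let ?P = "\<lambda>i. trunc \<mu> O' (P i)" and ?P' = "\<lambda>i. trunc \<mu> O' (P' i)"
  have okA: "outcome_ok I O' Q A" and okR: "outcome_ok I O' Q R"
    using ok A R unfolding outcome_ok_def by (fastforce, fastforce)
  have dP: "distribution_on O' (?P i)" "distribution_on O' (?P' i)" if "i \<in> I" for i
    using distribution_trunc[OF \<mu>] P P' that by blast+
  define x where "x = absorb I (round_kernel O' ?P Q) (round_reward O' ?P A) i"
  define x' where "x' = absorb I (round_kernel O' ?P' Q) (round_reward O' ?P' A) i"
  define y' where "y' = absorb I (round_kernel O' ?P' Q) (round_reward O' ?P' R) i"
  note sub = substochastic_round[where P = ?P, OF okA dP(1)]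
    substochastic_round[where P = ?P', OF okA dP(2)] substochastic_round[where P = ?P', OF okR dP(2)]
  have x: "1 / 2 + \<delta> \<le> x" using acc chain_iter_trunc[where P = P, OF okA P \<mu> i, where m = m]
      chain_iter_le_absorb[OF sub(1) i, where m = m] unfolding x_def by linarith
  have y: "1 / 2 + \<delta> \<le> y'" using rej chain_iter_trunc[where P = P', OF okR P' \<mu> i, where m = m]
      chain_iter_le_absorb[OF sub(3) i, where m = m] unfolding y'_def by linarith
  \<comment> \<open>Acceptance and rejection are now read off the same truncated chain, so they
    share a total of at most 1.\<close>
  have "x' + y' \<le> 1" unfolding x'_def y'_def
  proof (rule absorb_disjoint_targets[OF _ _ _ i])
    have "(\<lambda>i. round_reward O' ?P' A i + round_reward O' ?P' R i) =
      round_reward O' ?P' (\<lambda>o'. A o' + R o')"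
      by (simp add: fun_eq_iff round_reward_def distrib_left sum.distrib)
    then show "substochastic I (round_kernel O' ?P' Q)
       (\<lambda>i. round_reward O' ?P' A i + round_reward O' ?P' R i)"
      using substochastic_round[OF ok dP(2)] by simp
  qed (use sub in \<open>auto simp: substochastic_def\<close>)
  \<comment> \<open>Truncation turns \<beta> into its square, and each of the \<open>card I\<close>
    row exchanges squares once more; hence the exponent \<open>4 * card I\<close>.\<close>
  moreover have "x \<le> (\<beta>\<^sup>2) ^ (2 * card I) * x'" unfolding x_def x'_def
  proof (rule absorb_close[OF sub(1,2) i])
    show "1 \<le> \<beta>\<^sup>2" using \<beta> by (simp add: one_le_power)
    fix k assume k: "k \<in> I"
    have "P' k o' \<le> \<beta> * P k o' \<and> P k o' \<le> \<beta> * P' k o'" if "o' \<in> O'" "\<mu> \<le> P' k o'" for o'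
      using cl[OF k that(1)] that by linarith
    then show "row_close (\<beta>\<^sup>2) I (round_kernel O' ?P Q k) (round_reward O' ?P A k)
        (round_kernel O' ?P' Q k) (round_reward O' ?P' A k)"
      using cl k \<beta> by (intro row_close_round[OF okA] dP trunc_close[OF \<mu>] P P') auto
  qed
  moreover have "(\<beta>\<^sup>2) ^ (2 * card I) = \<beta> ^ (4 * card I)" by (simp flip: power_mult)
  moreover have "0 \<le> x'" unfolding x'_def by (rule absorb_bounds[OF sub(2) i])
  ultimately have "x \<le> exp \<delta> * (1 - y')"
    using \<delta>(1) by (smt (verit) mult_right_mono mult_left_mono exp_gt_zero)
  also have "\<dots> \<le> exp \<delta> * (1 / 2 - \<delta>)" using y by (intro mult_left_mono) auto
  finally have "exp (-\<delta>) * (1 / 2 + \<delta>) \<le> exp (-\<delta>) * (exp \<delta> * (1 / 2 - \<delta>))"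
    using x by (intro mult_left_mono) auto
  then have "exp (-\<delta>) * (1 / 2 + \<delta>) \<le> 1 / 2 - \<delta>"
    by (simp flip: exp_add add: mult.assoc[symmetric])
  \<comment> \<open>Replacing \<open>exp (- \<delta>)\<close> by \<open>1 - \<delta>\<close> leaves
    a quadratic inequality equivalent to \<open>3 / 2 * \<delta> \<le> \<delta> * \<delta>\<close>,
    which fails for \<open>0 < \<delta> < 1\<close>.\<close>
  moreover have "(1 - \<delta>) * (1 / 2 + \<delta>) \<le> exp (-\<delta>) * (1 / 2 + \<delta>)"
    using exp_ge_add_one_self[of "-\<delta>"] \<delta> by (intro mult_right_mono) auto
  ultimately have "(1 - \<delta>) * (1 / 2 + \<delta>) \<le> 1 / 2 - \<delta>" by linarith
  then have "1 / 2 + \<delta> / 2 - \<delta> * \<delta> \<le> 1 / 2 - \<delta>" by (simp add: field_simps)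
  moreover have "\<delta> * \<delta> < \<delta> * 1" using \<delta> by (intro mult_strict_left_mono) auto
  ultimately show False using \<delta> by linarith
qed

section \<open>Reduction of the machine to a chain on boundary memories\<close>

section \<open>Crossings of the boundary between two tape segments\<close>

instance move :: finite
proof
  have "(UNIV :: move set) = {MoveLeft, Stay, MoveRight}"
    by (auto intro: move.exhaust)
  then show "finite (UNIV :: move set)" by (metis finite.emptyI finite.insertI)
qed

type_synonym ('q, 'g) mem = "'q \<times> (int \<Rightarrow> 'g) \<times> int"

datatype 'k outcome = Exit 'k | Accepted | Rejected | Stuck

definition mem :: "('q, 'g) config \<Rightarrow> ('q, 'g) mem" where
  "mem c = (state c, work_tape c, work_pos c)"

definition place :: "int \<Rightarrow> ('q, 'g) mem \<Rightarrow> ('q, 'g) config" where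
  "place p k = \<lparr>state = fst k, input_pos = p, work_tape = fst (snd k), work_pos = snd (snd k)\<rparr>"

definition successor :: "('q, 'g) config \<Rightarrow> 'q \<times> 'g \<times> move \<times> move \<Rightarrow> ('q, 'g) config" where
  "successor c = (\<lambda>(q', g', d, e).
     \<lparr>state = q', input_pos = input_pos c + offset d,
      work_tape = (work_tape c)(work_pos c := g'), work_pos = work_pos c + offset e\<rparr>)"

text \<open>Depends on a tape content instead of an input word, so that it also serves a segment
  with its own head coordinates.\<close>

definition choices ::
    "('q, 'g, 'a) ptm \<Rightarrow> 'a input_symbol list \<Rightarrow> ('q, 'g) config \<Rightarrow> ('q \<times> 'g \<times> move \<times> move) pmf" where
  "choices M u c = trans M (state c) (u ! nat (input_pos c)) (work_tape c (work_pos c))"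

lemma step_eq:
  "step M w c = (if state c \<in> halting_states M then return_pmf c
     else map_pmf (successor c) (choices M (input_tape w) c))"
  by (simp add: step_def successor_def choices_def)

lemma place_simps [simp]:
  "input_pos (place p k) = p" "mem (place p k) = k" "place (input_pos c) (mem c) = c"
  "(place p k)\<lparr>input_pos := p'\<rparr> = place p' k"
  by (simp_all add: place_def mem_def)

text \<open>Probability of being in S after strictly fewer than t steps, without the memory leaving G.\<close>

primrec hit :: "('q::finite, 'g::finite, 'a) ptm \<Rightarrow> ('q, 'g) mem set \<Rightarrow> 'a input_symbol list \<Rightarrow>
    'q set \<Rightarrow> nat \<Rightarrow> ('q, 'g) config \<Rightarrow> real" where
  "hit M G u S 0 c = 0"
| "hit M G u S (Suc t) c =
    (if state c \<in> halting_states M then of_bool (state c \<in> S)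
     else if mem c \<notin> G then 0
     else \<Sum>x\<in>UNIV. pmf (choices M u c) x * hit M G u S t (successor c x))"

lemma hit_nonneg: "0 \<le> hit M G u S t c"
  by (induction t arbitrary: c) (auto intro!: sum_nonneg)

lemma hit_Suc_ge: "hit M G u S t c \<le> hit M G u S (Suc t) c"
proof (induction t arbitrary: c)
  case (Suc t)
  have "(\<Sum>x\<in>UNIV. pmf (choices M u c) x * hit M G u S t (successor c x))
    \<le> (\<Sum>x\<in>UNIV. pmf (choices M u c) x * hit M G u S (Suc t) (successor c x))"
    using Suc by (intro sum_mono mult_left_mono) auto
  then show ?case by (simp only: hit.simps(2)) simp
qed (use hit_nonneg[of M G u S "Suc 0" c] in simp)

lemma hit_mono: "t \<le> t' \<Longrightarrow> hit M G u S t c \<le> hit M G u S t' c"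
  by (rule lift_Suc_mono_le[of "\<lambda>t. hit M G u S t c"]) (rule hit_Suc_ge)

text \<open>The segment u carries positions 0 up to length u - 1; a run is cut off, and counts as
  stuck, when the time is up or the memory leaves G.\<close>

primrec seg :: "('q::finite, 'g::finite, 'a) ptm \<Rightarrow> ('q, 'g) mem set \<Rightarrow> 'a input_symbol list \<Rightarrow>
    nat \<Rightarrow> ('q, 'g) config \<Rightarrow> ('q, 'g) mem outcome \<Rightarrow> real" where
  "seg M G u 0 c = (\<lambda>r. of_bool (r = Stuck))"
| "seg M G u (Suc t) c =
    (if state c = accept_state M then (\<lambda>r. of_bool (r = Accepted))
     else if state c = reject_state M then (\<lambda>r. of_bool (r = Rejected))
     else if mem c \<notin> G then (\<lambda>r. of_bool (r = Stuck))
     else if input_pos c \<notin> {0..<int (length u)} then (\<lambda>r. of_bool (r = Exit (mem c)))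
     else (\<lambda>r. \<Sum>x\<in>UNIV. pmf (choices M u c) x * seg M G u t (successor c x) r))"

definition outcomes :: "'k set \<Rightarrow> 'k outcome set" where
  "outcomes G = Exit ` G \<union> {Accepted, Rejected, Stuck}"

lemma finite_outcomes [simp]: "finite G \<Longrightarrow> finite (outcomes G)"
  by (simp add: outcomes_def)

lemma in_outcomes [simp]:
  "Exit k \<in> outcomes G \<longleftrightarrow> k \<in> G" "Accepted \<in> outcomes G" "Rejected \<in> outcomes G" "Stuck \<in> outcomes G"
  by (auto simp: outcomes_def)

lemma sum_outcomes:
  assumes "finite G"
  shows "(\<Sum>r\<in>outcomes G. f r) = (\<Sum>k\<in>G. f (Exit k)) + f Accepted + f Rejected + (f Stuck :: real)"
proof -
  have "(\<Sum>r\<in>outcomes G. f r) = (\<Sum>r\<in>Exit ` G. f r) + (\<Sum>r\<in>{Accepted, Rejected, Stuck}. f r)"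
    unfolding outcomes_def using assms by (intro sum.union_disjoint) auto
  also have "(\<Sum>r\<in>Exit ` G. f r) = (\<Sum>k\<in>G. f (Exit k))"
    by (subst sum.reindex) (auto simp: inj_on_def)
  finally show ?thesis by simp
qed

lemma card_outcomes: "finite G \<Longrightarrow> card (outcomes G) = card G + 3"
  using sum_outcomes[of G "\<lambda>_. 1"] by simp

lemma sum_of_bool_eq_mult:
  "finite A \<Longrightarrow> a \<in> A \<Longrightarrow> (\<Sum>r\<in>A. of_bool (r = a) * f r) = (f a :: real)"
  by (simp add: of_bool_def if_distrib[of "\<lambda>x. x * _"] cong: if_cong)

lemma sum_pmf_UNIV: "(\<Sum>x\<in>(UNIV :: 'x::finite set). pmf p x) = 1"
  by (rule sum_pmf_eq_1) auto

lemma seg_nonneg: "0 \<le> seg M G u t c r"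
  by (induction t arbitrary: c) (auto intro!: sum_nonneg)

text \<open>Runs that are cut off go to \<open>Stuck\<close>, so no mass is lost even if the machine
  never leaves the segment. Membership in \<open>G\<close> is tested before the head position, so an
  \<open>Exit\<close> always carries a memory from \<open>G\<close>.\<close>

lemma distribution_seg:
  assumes "finite G"
  shows "distribution_on (outcomes G) (seg M G u t c)"
proof -
  have b: "(\<Sum>r\<in>outcomes G. of_bool (r = a)) = (1 :: real)" if "a \<in> outcomes G" for a
    using sum_of_bool_eq_mult[of "outcomes G" a "\<lambda>_. 1"] that assms by simp
  have "(\<Sum>r\<in>outcomes G. seg M G u t c r) = 1"
  proof (induction t arbitrary: c)
    case (Suc t)
    have "(\<Sum>r\<in>outcomes G. \<Sum>x\<in>UNIV. pmf (choices M u c) x * seg M G u t (successor c x) r) =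
      (\<Sum>x\<in>UNIV. pmf (choices M u c) x * (\<Sum>r\<in>outcomes G. seg M G u t (successor c x) r))"
      by (subst sum.swap) (simp add: sum_distrib_left)
    also have "\<dots> = 1" by (simp add: Suc sum_pmf_UNIV)
    finally show ?case by (simp add: b)
  qed (simp add: b)
  then show ?thesis using assms by (simp add: distribution_on_def seg_nonneg)
qed

lemma successor_in_tape:
  assumes M: "is_ptm M" and c: "state c \<notin> halting_states M"
    and pos: "0 \<le> input_pos c" "input_pos c < int (length (input_tape w))"
    and x: "pmf (choices M (input_tape w) c) x \<noteq> 0"
  shows "0 \<le> input_pos (successor c x)" "input_pos (successor c x) < int (length (input_tape w))"
proof -
  obtain q' g' d e where x_eq: "x = (q', g', d, e)" by (cases x)
  let ?\<sigma> = "input_tape w ! nat (input_pos c)"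
  have "x \<in> set_pmf (choices M (input_tape w) c)" using x by (simp add: set_pmf_iff)
  then have d: "?\<sigma> = LeftEnd \<Longrightarrow> d \<noteq> MoveLeft" "?\<sigma> = RightEnd \<Longrightarrow> d \<noteq> MoveRight"
    using M c unfolding is_ptm_def choices_def x_eq by fastforce+
  have "?\<sigma> = LeftEnd" if "input_pos c = 0" using that by (simp add: input_tape_def)
  then have L: "d \<noteq> MoveLeft" if "input_pos c = 0" using that d by blast
  have "?\<sigma> = RightEnd" if "input_pos c = int (length w) + 1"
    using that by (simp add: input_tape_def nat_add_distrib nth_append)
  then have R: "d \<noteq> MoveRight" if "input_pos c = int (length w) + 1" using that d by blast
  have len: "int (length (input_tape w)) = int (length w) + 2" by (simp add: input_tape_def)
  have succ: "input_pos (successor c x) = input_pos c + offset d" by (simp add: successor_def x_eq)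
  show "0 \<le> input_pos (successor c x)"
    using L pos unfolding succ by (cases d; cases "input_pos c = 0") auto
  show "input_pos (successor c x) < int (length (input_tape w))"
    using R pos unfolding succ len by (cases d; cases "input_pos c = int (length w) + 1") auto
qed

text \<open>Decomposition at the first exit from the segment \<open>u\<close>, where
  \<open>\<phi> r\<close> bounds the chance of success after outcome \<open>r\<close>. Only an
  inequality results, since every exit is granted the full remaining time \<open>n\<close>. The
  cut-off at \<open>tm\<close> is harmless because \<open>t\<close> does not exceed it. From inside
  the segment an exit costs at least one step, so there the budget may be
  \<open>Suc n\<close>.\<close>

lemma hit_le_seg:
  assumes M: "is_ptm M" and tape: "input_tape w = u0 @ u @ u'" and G: "finite G"
    and \<phi>: "\<And>r. r \<in> outcomes G \<Longrightarrow> 0 \<le> \<phi> r"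
      "of_bool (accept_state M \<in> S) \<le> \<phi> Accepted" "of_bool (reject_state M \<in> S) \<le> \<phi> Rejected"
    and exit: "\<And>c. 0 \<le> input_pos c \<Longrightarrow> input_pos c < int (length (input_tape w)) \<Longrightarrow> mem c \<in> G \<Longrightarrow>
      input_pos c = int (length u0) - 1 \<or> input_pos c = int (length (u0 @ u)) \<Longrightarrow>
      hit M G (input_tape w) S n c \<le> \<phi> (Exit (mem c))"
    and pos: "0 \<le> input_pos c" "input_pos c < int (length (input_tape w))"
      "int (length u0) - 1 \<le> input_pos c" "input_pos c \<le> int (length (u0 @ u))"
    and t: "t \<le> tm"
      "t \<le> n \<or> t \<le> Suc n \<and> int (length u0) \<le> input_pos c \<and> input_pos c < int (length (u0 @ u))"
  shows "hit M G (input_tape w) S t c \<le>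
    (\<Sum>r\<in>outcomes G. seg M G u tm (c\<lparr>input_pos := input_pos c - int (length u0)\<rparr>) r * \<phi> r)"
  using pos t
proof (induction tm arbitrary: t c)
  case 0
  then show ?case by (auto intro!: sum_nonneg mult_nonneg_nonneg seg_nonneg \<phi>)
next
  case (Suc tm)
  let ?sh = "\<lambda>c. c\<lparr>input_pos := input_pos c - int (length u0)\<rparr>"
  let ?T = "input_tape w"
  have nonneg: "0 \<le> (\<Sum>r\<in>outcomes G. seg M G u (Suc tm) (?sh c) r * \<phi> r)"
    by (intro sum_nonneg mult_nonneg_nonneg seg_nonneg \<phi>)
  have mem_sh: "mem (?sh c) = mem c" by (simp add: mem_def)
  have point: "(\<Sum>r\<in>outcomes G. of_bool (r = a) * \<phi> r) = \<phi> a" if "a \<in> outcomes G" for a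
    using G that by (intro sum_of_bool_eq_mult) auto
  show ?case
  proof (cases t)
    case 0
    then show ?thesis using nonneg by simp
  next
    case (Suc t')
    consider "state c \<in> halting_states M" | "state c \<notin> halting_states M" "mem c \<notin> G"
      | "state c \<notin> halting_states M" "mem c \<in> G"
        "input_pos c < int (length u0) \<or> int (length (u0 @ u)) \<le> input_pos c"
      | "state c \<notin> halting_states M" "mem c \<in> G"
        "int (length u0) \<le> input_pos c" "input_pos c < int (length (u0 @ u))"
      by linarith
    then show ?thesis
    proof cases
      case 1
      then show ?thesis using Suc \<phi>(2,3) M
        by (auto simp: halting_states_def point is_ptm_def)
    next
      case 2
      then show ?thesis using Suc nonneg by simp
    next
      case 3
      then have "hit M G ?T S t c \<le> hit M G ?T S n c" using Suc.prems by (intro hit_mono) auto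
      also have "\<dots> \<le> \<phi> (Exit (mem c))" using 3 Suc.prems by (intro exit) auto
      also have "\<dots> = (\<Sum>r\<in>outcomes G. seg M G u (Suc tm) (?sh c) r * \<phi> r)"
        using 3 by (auto simp: halting_states_def mem_sh point)
      finally show ?thesis .
    next
      case 4
      have sym: "?T ! nat (input_pos c) = u ! nat (input_pos c - int (length u0))"
      proof -
        obtain k where k: "input_pos c = int (length u0) + int k" using 4(3) zle_iff_zadd by blast
        then have "k < length u" using 4(4) by simp
        moreover have "nat (input_pos c) = length u0 + k" using k by simp
        ultimately show ?thesis unfolding k by (simp add: tape nth_append)
      qed
      have ch: "choices M u (?sh c) = choices M ?T c" by (simp add: choices_def sym)
      have succ: "successor (?sh c) x = ?sh (successor c x)" for x
        by (cases x) (simp add: successor_def)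
      have "pmf (choices M ?T c) x * hit M G ?T S t' (successor c x) \<le>
        pmf (choices M ?T c) x * (\<Sum>r\<in>outcomes G. seg M G u tm (?sh (successor c x)) r * \<phi> r)" for x
      proof (cases "pmf (choices M ?T c) x = 0")
        case False
        \<comment> \<open>The head moves by at most one cell, so the successor is inside the segment
          or on one of its two neighbouring positions.\<close>
        have "\<bar>input_pos (successor c x) - input_pos c\<bar> \<le> 1"
          by (cases x; cases "fst (snd (snd x))") (auto simp: successor_def)
        with successor_in_tape[OF M 4(1) Suc.prems(1,2) False] show ?thesis
          using Suc Suc.prems 4(3,4) by (intro mult_left_mono Suc.IH) auto
      qed simp
      then have "hit M G ?T S t c \<le> (\<Sum>x\<in>UNIV. pmf (choices M ?T c) x *
          (\<Sum>r\<in>outcomes G. seg M G u tm (?sh (successor c x)) r * \<phi> r))"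
        using Suc 4 by (auto intro: sum_mono)
      also have "\<dots> = (\<Sum>r\<in>outcomes G. (\<Sum>x\<in>UNIV. pmf (choices M ?T c) x *
          seg M G u tm (?sh (successor c x)) r) * \<phi> r)"
        by (subst sum_distrib_right, subst sum.swap) (simp add: sum_distrib_left mult.assoc)
      also have "\<dots> = (\<Sum>r\<in>outcomes G. seg M G u (Suc tm) (?sh c) r * \<phi> r)"
        using 4 by (simp add: mem_sh ch succ halting_states_def)
      finally show ?thesis .
    qed
  qed
qed

definition chain_rows :: "'k set \<Rightarrow> 'k option set" where
  "chain_rows G = insert None (Some ` G)"

text \<open>Row None is the start of the computation, row Some k the re-entry into the left part of the
  tape from the right with memory k.\<close>

primrec row_start :: "('q, 'g, 'a) ptm \<Rightarrow> 'a list \<Rightarrow> ('q, 'g) mem option \<Rightarrow> ('q, 'g) config" where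
  "row_start M w None = init_config M"
| "row_start M w (Some k) = place (int (length w)) k"

definition left_run :: "('q::finite, 'g::finite, 'a) ptm \<Rightarrow> ('q, 'g) mem set \<Rightarrow> 'a list \<Rightarrow>
    nat \<Rightarrow> ('q, 'g) mem option \<Rightarrow> ('q, 'g) mem outcome \<Rightarrow> real" where
  "left_run M G w t i = seg M G (LeftEnd # map Letter w) t (row_start M w i)"

definition right_run :: "('q::finite, 'g::finite, 'a) ptm \<Rightarrow> ('q, 'g) mem set \<Rightarrow> 'a list \<Rightarrow>
    nat \<Rightarrow> ('q, 'g) mem \<Rightarrow> ('q, 'g) mem outcome \<Rightarrow> real" where
  "right_run M G v t k = seg M G (map Letter v @ [RightEnd]) t (place 0 k)"

definition halt_reward :: "('q, 'g, 'a) ptm \<Rightarrow> 'q set \<Rightarrow> 'k outcome \<Rightarrow> real" where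
  "halt_reward M S r = of_bool (r = Accepted \<and> accept_state M \<in> S \<or> r = Rejected \<and> reject_state M \<in> S)"

text \<open>The second half of a round: after an \<open>Exit\<close> of the left run the right
  segment takes over, while every other left outcome is final. The share of right runs that get
  stuck is neither rewarded here nor continued by \<open>right_goto\<close>.\<close>

definition right_reward :: "('q::finite, 'g::finite, 'a) ptm \<Rightarrow> ('q, 'g) mem set \<Rightarrow> 'a list \<Rightarrow>
    nat \<Rightarrow> 'q set \<Rightarrow> ('q, 'g) mem outcome \<Rightarrow> real" where
  "right_reward M G v t S r =
    (case r of Exit k \<Rightarrow> \<Sum>r\<in>{Accepted, Rejected}. right_run M G v t k r * halt_reward M S r
     | _ \<Rightarrow> halt_reward M S r)"

definition right_goto :: "('q::finite, 'g::finite, 'a) ptm \<Rightarrow> ('q, 'g) mem set \<Rightarrow> 'a list \<Rightarrow>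
    nat \<Rightarrow> ('q, 'g) mem outcome \<Rightarrow> ('q, 'g) mem option \<Rightarrow> real" where
  "right_goto M G v t r j =
    (case r of Exit k \<Rightarrow> (case j of None \<Rightarrow> 0 | Some k' \<Rightarrow> right_run M G v t k (Exit k')) | _ \<Rightarrow> 0)"

lemma sum_chain_rows: "finite G \<Longrightarrow> (\<Sum>j\<in>chain_rows G. f j) = f None + (\<Sum>k\<in>G. (f (Some k) :: real))"
  unfolding chain_rows_def by (subst sum.insert) (auto simp: sum.reindex)

lemma card_chain_rows: "finite G \<Longrightarrow> card (chain_rows G) = Suc (card G)"
  unfolding chain_rows_def by (subst card_insert_disjoint) (auto simp: card_image)

lemma outcome_ok_right:
  assumes G: "finite G" and M: "is_ptm M"
  shows "outcome_ok (chain_rows G) (outcomes G) (right_goto M G v t)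
    (\<lambda>r. right_reward M G v t {accept_state M} r + right_reward M G v t {reject_state M} r)"
proof -
  have ne: "accept_state M \<noteq> reject_state M" using M by (simp add: is_ptm_def)
  have nn: "0 \<le> right_run M G v t k r" for k r by (simp add: right_run_def seg_nonneg)
  have "right_reward M G v t {accept_state M} r + right_reward M G v t {reject_state M} r
      + (\<Sum>j\<in>chain_rows G. right_goto M G v t r j) \<le> 1" for r
  proof (cases r)
    case (Exit k)
    have "(\<Sum>k'\<in>G. right_run M G v t k (Exit k')) + right_run M G v t k Accepted
      + right_run M G v t k Rejected + right_run M G v t k Stuck = 1"
      using distribution_seg[OF G, of M "map Letter v @ [RightEnd]" t "place 0 k"] sum_outcomes[OF G]
      by (simp add: distribution_on_def right_run_def)
    then show ?thesis using nn[of k Stuck] ne Exit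
      by (simp add: right_reward_def right_goto_def halt_reward_def sum_chain_rows[OF G])
  qed (use ne in \<open>simp_all add: right_reward_def right_goto_def halt_reward_def sum_chain_rows[OF G]\<close>)
  then show ?thesis using nn G
    by (auto simp: outcome_ok_def chain_rows_def right_reward_def right_goto_def halt_reward_def
        split: outcome.splits option.splits intro!: add_nonneg_nonneg)
qed

text \<open>Every round spends at least one step in the left part, so \<open>t\<close> steps fit
  into \<open>t\<close> rounds and one number serves as time and as round count. The decomposition
  is applied first to the right segment with budget \<open>t\<close> and then to the left one with
  budget \<open>Suc t\<close>.\<close>

lemma hit_le_rounds:
  fixes M :: "('q::finite, 'g::finite, 'a::finite) ptm"
  assumes M: "is_ptm M" and G: "finite G" and t: "t \<le> tm" and i: "i \<in> chain_rows G"
  shows "hit M G (input_tape (w @ v)) S t (row_start M w i) \<le>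
    chain_iter (chain_rows G) (round_kernel (outcomes G) (left_run M G w tm) (right_goto M G v tm))
      (round_reward (outcomes G) (left_run M G w tm) (right_reward M G v tm S)) t i"
  using t i
proof (induction t arbitrary: i)
  case (Suc t)
  let ?T = "input_tape (w @ v)" and ?u = "LeftEnd # map Letter w" and ?u' = "map Letter v @ [RightEnd]"
  let ?H = "chain_iter (chain_rows G) (round_kernel (outcomes G) (left_run M G w tm) (right_goto M G v tm))
      (round_reward (outcomes G) (left_run M G w tm) (right_reward M G v tm S)) t"
  let ?F = "\<lambda>r. right_reward M G v tm S r + (\<Sum>j\<in>chain_rows G. right_goto M G v tm r j * ?H j)"
  have tape: "?T = ?u @ ?u'" by (simp add: input_tape_def)
  have H: "hit M G ?T S t (row_start M w i) \<le> ?H i" if "i \<in> chain_rows G" for i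
    using Suc.IH[OF _ that] Suc.prems by simp
  have H0: "0 \<le> ?H i" if "i \<in> chain_rows G" for i using H[OF that] hit_nonneg order_trans by blast
  have F0: "0 \<le> ?F r" for r
    using H0 by (auto simp: right_reward_def right_goto_def halt_reward_def right_run_def seg_nonneg
        split: outcome.splits option.splits intro!: add_nonneg_nonneg sum_nonneg mult_nonneg_nonneg)
  have right: "hit M G ?T S t (place (int (length ?u)) k) \<le> ?F (Exit k)" for k
  proof -
    define \<psi> where "\<psi> r = (case r of Exit k' \<Rightarrow> ?H (Some k') | _ \<Rightarrow> halt_reward M S r)" for r
    have "hit M G ?T S t (place (int (length ?u)) k) \<le> (\<Sum>r\<in>outcomes G. seg M G ?u' tm
      ((place (int (length ?u)) k)\<lparr>input_pos := input_pos (place (int (length ?u)) k) - int (length ?u)\<rparr>) r * \<psi> r)"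
    proof (rule hit_le_seg[OF M _ G, where u' = "[]" and n = t])
      show "input_tape (w @ v) = ?u @ ?u' @ []" using tape by simp
      show "0 \<le> \<psi> r" if "r \<in> outcomes G" for r
        using that H0 by (auto simp: \<psi>_def halt_reward_def chain_rows_def split: outcome.splits)
      fix c :: "('q, 'g) config" assume c: "0 \<le> input_pos c" "input_pos c < int (length ?T)" "mem c \<in> G"
        "input_pos c = int (length ?u) - 1 \<or> input_pos c = int (length (?u @ ?u'))"
      \<comment> \<open>An exit to the right would lie beyond the tape, so only the boundary between
        the two parts remains.\<close>
      then have "input_pos c = int (length w)" by (simp add: input_tape_def)
      then have "c = row_start M w (Some (mem c))" by (metis place_simps(3) row_start.simps(2))
      then show "hit M G ?T S t c \<le> \<psi> (Exit (mem c))"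
        using H[of "Some (mem c)"] c by (simp add: \<psi>_def chain_rows_def)
    qed (use Suc.prems in \<open>auto simp: \<psi>_def halt_reward_def input_tape_def\<close>)
    also have "\<dots> = ?F (Exit k)"
      by (simp add: sum_outcomes[OF G] sum_chain_rows[OF G] right_run_def \<psi>_def right_reward_def
          right_goto_def halt_reward_def)
    finally show ?thesis .
  qed
  define \<phi> where "\<phi> r = (case r of Exit k \<Rightarrow> hit M G ?T S t (place (int (length ?u)) k)
    | _ \<Rightarrow> halt_reward M S r)" for r
  let ?c = "row_start M w i"
  have pos: "0 \<le> input_pos ?c" "input_pos ?c < int (length ?u)"
    by (cases i; simp add: init_config_def)+
  have "hit M G ?T S (Suc t) ?c \<le> (\<Sum>r\<in>outcomes G. seg M G ?u tm
      (?c\<lparr>input_pos := input_pos ?c - int (length ([] :: 'a input_symbol list))\<rparr>) r * \<phi> r)"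
  proof (rule hit_le_seg[OF M _ G, where u' = ?u' and n = t])
    show "input_tape (w @ v) = [] @ ?u @ ?u'" using tape by simp
    show "0 \<le> \<phi> r" for r
      by (auto simp: \<phi>_def halt_reward_def hit_nonneg split: outcome.splits)
    fix c :: "('q, 'g) config" assume c: "0 \<le> input_pos c" "input_pos c < int (length ?T)" "mem c \<in> G"
      "input_pos c = int (length ([] :: 'a input_symbol list)) - 1 \<or> input_pos c = int (length ([] @ ?u))"
    then have "input_pos c = int (length ?u)" by simp
    then have "place (int (length ?u)) (mem c) = c" by (metis place_simps(3))
    then show "hit M G ?T S t c \<le> \<phi> (Exit (mem c))"
      by (simp add: \<phi>_def)
  qed (use Suc.prems pos in \<open>auto simp: \<phi>_def halt_reward_def input_tape_def\<close>)
  also have "\<dots> = (\<Sum>r\<in>outcomes G. left_run M G w tm i r * \<phi> r)"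
    by (simp add: left_run_def)
  also have "\<dots> \<le> (\<Sum>r\<in>outcomes G. left_run M G w tm i r * ?F r)"
  proof (intro sum_mono mult_left_mono)
    show "\<phi> r \<le> ?F r" for r
    proof (cases r)
      case (Exit k)
      then show ?thesis using right[of k] by (simp add: \<phi>_def)
    qed (auto simp: \<phi>_def right_reward_def right_goto_def)
  qed (simp add: left_run_def seg_nonneg)
  finally show ?case by (simp only: chain_iter_Suc round_step)
qed simp

section \<open>Halting probabilities expressed through \<open>hit\<close>\<close>

primrec steps :: "('q, 'g, 'a) ptm \<Rightarrow> 'a list \<Rightarrow> nat \<Rightarrow> ('q, 'g) config \<Rightarrow> ('q, 'g) config pmf" where
  "steps M w 0 c = return_pmf c"
| "steps M w (Suc t) c = bind_pmf (step M w c) (steps M w t)"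

text \<open>\<open>run\<close> appends the last step, whereas \<open>steps\<close> peels off the
  first one, as the recursion of \<open>hit\<close> does.\<close>

lemma run_eq_steps: "run M w t = steps M w t (init_config M)"
proof -
  have "bind_pmf (steps M w t c) (step M w) = steps M w (Suc t) c" for t c
  proof (induction t arbitrary: c)
    case 0
    have "steps M w 0 = return_pmf" by (simp add: fun_eq_iff)
    then show ?case by (simp add: bind_return_pmf bind_return_pmf')
  next
    case (Suc t)
    then have "(\<lambda>c. bind_pmf (steps M w t c) (step M w)) = steps M w (Suc t)" by blast
    then show ?case by (simp only: steps.simps bind_assoc_pmf)
  qed
  then show ?thesis by (induction t) simp_all
qed

lemma steps_halted:
  "state c \<in> halting_states M \<Longrightarrow> steps M w t c = return_pmf c"
  by (induction t) (simp_all add: step_eq bind_return_pmf)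

lemma computation_snoc:
  "computation M w cs \<Longrightarrow> c' \<in> set_pmf (step M w (last cs)) \<Longrightarrow> computation M w (cs @ [c'])"
  by (auto simp: computation_def successively_append_iff)

text \<open>The memory bound is known only along computations of positive probability, so the
  induction carries such a path ending in the current configuration; choices of probability 0 drop
  out of the sum. \<open>Suc t\<close> matches the strict time bound in \<open>hit\<close>.\<close>

lemma prob_steps_eq_hit:
  assumes G: "\<And>cs. computation M w cs \<Longrightarrow> mem (last cs) \<in> G" and S: "S \<subseteq> halting_states M"
    and cs: "computation M w cs"
  shows "measure_pmf.prob (steps M w t (last cs)) {c. state c \<in> S} =
    hit M G (input_tape w) S (Suc t) (last cs)"
  using cs
proof (induction t arbitrary: cs)
  case 0
  then show ?case using S by (auto simp: measure_return indicator_def)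
next
  case (Suc t)
  let ?c = "last cs" and ?h = "hit M G (input_tape w) S"
  show ?case
  proof (cases "state ?c \<in> halting_states M")
    case True
    then show ?thesis by (simp add: steps_halted indicator_def del: steps.simps)
  next
    case False
    let ?p = "choices M (input_tape w) ?c"
    have prob: "measure_pmf.prob p {c. state c \<in> S} = pmf (map_pmf (\<lambda>c. state c \<in> S) p) True" for p
      by (simp add: pmf_map vimage_def)
    have "measure_pmf.prob (steps M w (Suc t) ?c) {c. state c \<in> S} =
      (\<integral>x. measure_pmf.prob (steps M w t (successor ?c x)) {c. state c \<in> S} \<partial>?p)"
      using False by (simp add: prob step_eq bind_map_pmf map_bind_pmf pmf_bind)
    also have "\<dots> = (\<Sum>x\<in>UNIV. measure_pmf.prob (steps M w t (successor ?c x)) {c. state c \<in> S} * pmf ?p x)"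
      by (rule integral_measure_pmf_real) auto
    also have "\<dots> = (\<Sum>x\<in>UNIV. pmf ?p x * ?h (Suc t) (successor ?c x))"
    proof (rule sum.cong[OF refl])
      fix x
      show "measure_pmf.prob (steps M w t (successor ?c x)) {c. state c \<in> S} * pmf ?p x =
        pmf ?p x * ?h (Suc t) (successor ?c x)"
      proof (cases "pmf ?p x = 0")
        case False
        then have "successor ?c x \<in> set_pmf (step M w ?c)"
          using \<open>state ?c \<notin> halting_states M\<close> by (auto simp: step_eq set_pmf_iff)
        from Suc.IH[OF computation_snoc[OF Suc.prems this]] show ?thesis by simp
      qed simp
    qed
    finally show ?thesis using False G[OF Suc.prems] by (simp del: steps.simps)
  qed
qed

lemma prob_in_by_eq_hit:
  assumes "\<And>cs. computation M w cs \<Longrightarrow> mem (last cs) \<in> G" "S \<subseteq> halting_states M"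
  shows "prob_in_by M w S t = hit M G (input_tape w) S (Suc t) (init_config M)"
  using prob_steps_eq_hit[OF assms, where cs = "[init_config M]"]
  by (simp add: prob_in_by_def run_eq_steps computation_def del: hit.simps)

section \<open>Memory contents reachable in bounded space\<close>

definition bounded_mem :: "('q, 'g, 'a) ptm \<Rightarrow> nat \<Rightarrow> ('q, 'g) mem set" where
  "bounded_mem M N = {(q, f, p). \<bar>p\<bar> \<le> int N \<and> (\<forall>x. int N < \<bar>x\<bar> \<longrightarrow> f x = blank M)}"

lemma computation_induct [consumes 1, case_names init snoc]:
  assumes "computation M w cs"
    and "P [init_config M]"
    and "\<And>cs c. computation M w cs \<Longrightarrow> P cs \<Longrightarrow> c \<in> set_pmf (step M w (last cs)) \<Longrightarrow> P (cs @ [c])"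
  shows "P cs"
  using assms(1)
proof (induction cs rule: rev_induct)
  case (snoc c cs)
  show ?case
  proof (cases "cs = []")
    case True
    then show ?thesis using snoc.prems assms(2) by (simp add: computation_def)
  next
    case False
    then have "computation M w cs" "c \<in> set_pmf (step M w (last cs))"
      using snoc.prems by (auto simp: computation_def successively_append_iff)
    then show ?thesis using snoc.IH assms(3) by blast
  qed
qed (simp add: computation_def)

text \<open>The work head skips no cell, so the visited cells form an interval around 0. This turns
  their number, which is what space measures, into a bound on distances from the origin; unvisited
  cells are still blank.\<close>

lemma work_head_in_visited:
  assumes "computation M w cs"
  shows "{min 0 (work_pos (last cs))..max 0 (work_pos (last cs))} \<subseteq> work_pos ` set cs \<and>
    (\<forall>x. x \<notin> work_pos ` set cs \<longrightarrow> work_tape (last cs) x = blank M) \<and>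
    (\<forall>x\<in>work_pos ` set cs. {min 0 x..max 0 x} \<subseteq> work_pos ` set cs)"
  using assms
proof (induction rule: computation_induct)
  case init
  then show ?case by (simp add: init_config_def)
next
  case (snoc cs c)
  have ne: "cs \<noteq> []" using snoc by (simp add: computation_def)
  let ?V = "work_pos ` set cs"
  have "\<bar>work_pos c - work_pos (last cs)\<bar> \<le> 1 \<and> (\<forall>x. x \<noteq> work_pos (last cs) \<longrightarrow> work_tape c x = work_tape (last cs) x)"
  proof (cases "state (last cs) \<in> halting_states M")
    case True
    then show ?thesis using snoc by (simp add: step_eq)
  next
    case False
    then obtain y where y: "c = successor (last cs) y" using snoc by (auto simp: step_eq)
    show ?thesis unfolding y
      by (cases y; cases "snd (snd (snd y))") (auto simp: successor_def)
  qed
  then have d: "\<bar>work_pos c - work_pos (last cs)\<bar> \<le> 1"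
    and tp: "\<And>x. x \<noteq> work_pos (last cs) \<Longrightarrow> work_tape c x = work_tape (last cs) x" by auto
  have lastV: "work_pos (last cs) \<in> ?V" using ne by simp
  have sub: "{min 0 (work_pos c)..max 0 (work_pos c)} \<subseteq> insert (work_pos c) ?V"
  proof
    fix x assume x: "x \<in> {min 0 (work_pos c)..max 0 (work_pos c)}"
    show "x \<in> insert (work_pos c) ?V"
    proof (cases "x = work_pos c")
      case False
      then have "x \<in> {min 0 (work_pos (last cs))..max 0 (work_pos (last cs))}"
        using x d by (auto simp: min_def max_def split: if_splits)
      then show ?thesis using snoc.IH by blast
    qed simp
  qed
  have V: "work_pos ` set (cs @ [c]) = insert (work_pos c) ?V" by auto
  have "work_tape c x = blank M" if "x \<notin> insert (work_pos c) ?V" for x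
    using that tp[of x] lastV snoc.IH by (metis insertCI)
  moreover have "{min 0 x..max 0 x} \<subseteq> insert (work_pos c) ?V" if "x \<in> insert (work_pos c) ?V" for x
    using that sub snoc.IH by (metis insertE subset_insertI2)
  ultimately show ?case unfolding V using sub by simp
qed

lemma computation_in_bounded_mem:
  assumes cs: "computation M w cs" and space: "runs_within_space M w s" and N: "s \<le> real N"
  shows "mem (last cs) \<in> bounded_mem M N"
proof -
  have card: "card (work_pos ` set cs) \<le> N"
    using space cs N unfolding runs_within_space_def by (meson of_nat_le_iff order_trans)
  have bound: "\<bar>x\<bar> \<le> int N" if "x \<in> work_pos ` set cs" for x
  proof -
    have "card {min 0 x..max 0 x} \<le> card (work_pos ` set cs)"
      using work_head_in_visited[OF cs] that by (intro card_mono) auto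
    then have "nat (max 0 x + 1 - min 0 x) \<le> N" using card by simp
    then show ?thesis by (auto simp: min_def max_def split: if_splits)
  qed
  have "last cs \<in> set cs" using cs by (simp add: computation_def)
  show ?thesis
  proof -
    have "\<bar>work_pos (last cs)\<bar> \<le> int N" using bound \<open>last cs \<in> set cs\<close> by blast
    moreover have "work_tape (last cs) x = blank M" if "int N < \<bar>x\<bar>" for x
    proof -
      have "x \<notin> work_pos ` set cs" using bound[of x] that by linarith
      then show ?thesis using work_head_in_visited[OF cs] by blast
    qed
    ultimately show ?thesis by (simp add: bounded_mem_def mem_def)
  qed
qed

lemma bounded_mem_card:
  fixes M :: "('q::finite, 'g::finite, 'a::finite) ptm"
  shows "finite (bounded_mem M N)"
    "card (bounded_mem M N) \<le> card (UNIV :: 'q set) * (card (UNIV :: 'g set) ^ (2 * N + 1) * (2 * N + 1))"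
proof -
  let ?W = "{- int N..int N}"
  let ?F = "PiE ?W (\<lambda>_. UNIV :: 'g set)"
  let ?R = "(UNIV :: 'q set) \<times> (?F \<times> ?W)"
  let ?g = "\<lambda>(q, f, p). (q, (\<lambda>x. if x \<in> ?W then f x else blank M), p) :: ('q, 'g) mem"
  have W: "card ?W = 2 * N + 1" by simp
  have R: "finite ?R" "card ?R = card (UNIV :: 'q set) * (card (UNIV :: 'g set) ^ (2 * N + 1) * (2 * N + 1))"
  proof -
    have F: "finite ?F" by (intro finite_PiE) auto
    show "finite ?R" using F by (intro finite_SigmaI F) auto
    show "card ?R = card (UNIV :: 'q set) * (card (UNIV :: 'g set) ^ (2 * N + 1) * (2 * N + 1))"
      unfolding card_cartesian_product W by (simp add: card_PiE W del: card_atLeastAtMost_int)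
  qed
  have sub: "bounded_mem M N \<subseteq> ?g ` ?R"
  proof
    fix k :: "('q, 'g) mem" assume k: "k \<in> bounded_mem M N"
    obtain q f p where kq: "k = (q, f, p)" by (cases k)
    have "?g (q, restrict f ?W, p) = k"
    proof -
      have "(\<lambda>x. if x \<in> ?W then restrict f ?W x else blank M) = f"
      proof
        fix x
        show "(if x \<in> ?W then restrict f ?W x else blank M) = f x"
        proof (cases "x \<in> ?W")
          case False
          then have "int N < \<bar>x\<bar>" unfolding atLeastAtMost_iff by linarith
          then show ?thesis using k False by (simp add: kq bounded_mem_def)
        qed simp
      qed
      then show ?thesis unfolding kq prod.case by (simp only:)
    qed
    moreover have "p \<in> ?W" using k unfolding kq bounded_mem_def atLeastAtMost_iff by auto
    then have "(q, restrict f ?W, p) \<in> ?R" by (intro SigmaI UNIV_I restrict_PiE_iff[THEN iffD2] ballI)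
    ultimately show "k \<in> ?g ` ?R" by (intro image_eqI[of k ?g, OF sym])
  qed
  show "finite (bounded_mem M N)" using finite_subset[OF sub] R by blast
  show "card (bounded_mem M N) \<le> card (UNIV :: 'q set) * (card (UNIV :: 'g set) ^ (2 * N + 1) * (2 * N + 1))"
    using surj_card_le[OF R(1) sub] R(2) by simp
qed

section \<open>Cutting off late halting, and logarithmic rounding of exit probabilities\<close>

section \<open>Signatures of prefixes\<close>

lemma prob_in_by_mono:
  assumes "S \<subseteq> halting_states M" "t \<le> t'"
  shows "prob_in_by M w S t \<le> prob_in_by (M :: ('q::finite, 'g::finite, 'a::finite) ptm) w S t'"
proof -
  have "prob_in_by M w S t = hit M UNIV (input_tape w) S (Suc t) (init_config M)" for t
    using assms(1) by (intro prob_in_by_eq_hit) auto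
  then show ?thesis using assms(2) by (simp only: hit_mono Suc_le_mono)
qed

lemma prob_in_by_le_1: "prob_in_by M w S t \<le> 1"
  by (simp add: prob_in_by_def)

lemma prob_in_by_SUP:
  "bdd_above (range (prob_in_by M w S))" "prob_in_by M w S t \<le> (SUP t. prob_in_by M w S t)"
proof -
  show *: "bdd_above (range (prob_in_by M w S))"
    by (rule bdd_aboveI[of _ 1]) (auto simp: prob_in_by_le_1)
  show "prob_in_by M w S t \<le> (SUP t. prob_in_by M w S t)"
    by (rule cSUP_upper[OF UNIV_I *])
qed

lemma prob_in_by_split:
  assumes "S \<subseteq> H"
  shows "prob_in_by M w H t = prob_in_by M w S t + prob_in_by M w (H - S) t"
proof -
  have "{c. state c \<in> H} = {c. state c \<in> S} \<union> {c. state c \<in> H - S}" using assms by auto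
  moreover have "{c. state c \<in> S} \<inter> {c. state c \<in> H - S} = {}" by auto
  ultimately show ?thesis
    unfolding prob_in_by_def by (metis measure_pmf.finite_measure_Union UNIV_I sets_measure_pmf)
qed

text \<open>Markov's inequality. Multiplying the conditional expectation by
  \<open>halt_prob\<close>, which is at most 1, bounds the sum of
  \<open>real s * halt_at_prob M w s\<close> by \<tau>, and runs that do not halt contribute
  nothing. The bound for all halting states passes to \<open>S\<close> because the mass in the
  remaining halting states is nondecreasing too.\<close>

lemma prob_in_by_late:
  fixes M :: "('q::finite, 'g::finite, 'a::finite) ptm"
  assumes S: "S \<subseteq> halting_states M" and pos: "0 < halt_prob M w"
    and time: "cond_expected_time M w \<le> ennreal \<tau>" and \<tau>: "0 \<le> \<tau>" and t: "0 < t"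
  shows "(SUP t. prob_in_by M w S t) \<le> prob_in_by M w S t + \<tau> / real t"
proof -
  let ?H = "halting_states M"
  let ?f = "\<lambda>s. real s * halt_at_prob M w s"
  have h1: "halt_prob M w \<le> 1"
    unfolding halt_prob_def by (rule cSUP_least) (auto simp: prob_in_by_le_1)
  have at0: "0 \<le> halt_at_prob M w s" for s
  proof (cases s)
    case (Suc s')
    then show ?thesis using prob_in_by_mono[OF order_refl, of s' s M w] by (simp add: halt_at_prob_def)
  qed (simp add: halt_at_prob_def prob_in_by_def)
  have "(\<Sum>s. ennreal (?f s)) = cond_expected_time M w * ennreal (halt_prob M w)"
    unfolding cond_expected_time_def using pos
    by (subst mult.commute, subst ennreal_times_divide, subst mult.commute)
      (simp add: mult_divide_eq_ennreal)
  also have "\<dots> \<le> ennreal \<tau> * ennreal (halt_prob M w)" by (rule mult_right_mono[OF time]) simp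
  also have "\<dots> \<le> ennreal \<tau> * 1"
    using h1 by (intro mult_left_mono) (auto simp: ennreal_le_1)
  finally have total: "(\<Sum>s. ennreal (?f s)) \<le> ennreal \<tau>" by simp
  have sum: "(\<Sum>s<n. ?f s) \<le> \<tau>" for n
  proof -
    have "ennreal (\<Sum>s<n. ?f s) = (\<Sum>s<n. ennreal (?f s))" using at0 by (simp add: sum_ennreal)
    also have "\<dots> \<le> (\<Sum>s. ennreal (?f s))" by (rule sum_le_suminf) auto
    also note total
    finally show ?thesis using \<tau> by simp
  qed
  have late: "prob_in_by M w ?H (t + d) - prob_in_by M w ?H t \<le> \<tau> / real t" for d
  proof -
    have "prob_in_by M w ?H (t + d) - prob_in_by M w ?H t = (\<Sum>s=Suc t..<Suc t + d. halt_at_prob M w s)"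
      by (induction d) (auto simp: halt_at_prob_def)
    then have "real t * (prob_in_by M w ?H (t + d) - prob_in_by M w ?H t)
      = (\<Sum>s=Suc t..<Suc t + d. real t * halt_at_prob M w s)" by (simp only: sum_distrib_left)
    also have "\<dots> \<le> (\<Sum>s=Suc t..<Suc t + d. ?f s)"
      using at0 by (intro sum_mono mult_right_mono) auto
    also have "\<dots> \<le> (\<Sum>s<Suc t + d. ?f s)"
      using at0 by (intro sum_mono2) auto
    also have "\<dots> \<le> \<tau>" by (rule sum)
    finally show ?thesis using t by (simp add: field_simps)
  qed
  have "prob_in_by M w S s \<le> prob_in_by M w S t + \<tau> / real t" for s
  proof -
    have "prob_in_by M w S s \<le> prob_in_by M w S (t + s)"
      using S by (intro prob_in_by_mono) auto
    moreover have "prob_in_by M w (?H - S) t \<le> prob_in_by M w (?H - S) (t + s)"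
      by (intro prob_in_by_mono) auto
    ultimately show ?thesis
      using late[of s] prob_in_by_split[OF S, of M w t] prob_in_by_split[OF S, of M w "t + s"] by linarith
  qed
  then show ?thesis by (intro cSUP_least) auto
qed

text \<open>A logarithmic scale of step \<eta> above the threshold \<mu>. Value 0 is reserved for
  everything that truncation will remove.\<close>

definition bucket :: "real \<Rightarrow> real \<Rightarrow> real \<Rightarrow> nat" where
  "bucket \<mu> \<eta> p = (if p < \<mu> then 0 else Suc (nat \<lfloor>ln (p / \<mu>) / \<eta>\<rfloor>))"

lemma bucket_eqD:
  assumes eq: "bucket \<mu> \<eta> p = bucket \<mu> \<eta> p'" and \<mu>: "0 < \<mu>" and \<eta>: "0 < \<eta>"
  shows "p < \<mu> \<longleftrightarrow> p' < \<mu>" "\<mu> \<le> p \<Longrightarrow> p \<le> exp \<eta> * p'"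
proof -
  show iff: "p < \<mu> \<longleftrightarrow> p' < \<mu>" using eq by (auto simp: bucket_def split: if_splits)
  assume p: "\<mu> \<le> p"
  then have p': "\<mu> \<le> p'" using iff by auto
  have "0 \<le> ln (p / \<mu>) / \<eta>" "0 \<le> ln (p' / \<mu>) / \<eta>" using p p' \<mu> \<eta> by auto
  then have "0 \<le> \<lfloor>ln (p / \<mu>) / \<eta>\<rfloor>" "0 \<le> \<lfloor>ln (p' / \<mu>) / \<eta>\<rfloor>" by simp_all
  moreover have "nat \<lfloor>ln (p / \<mu>) / \<eta>\<rfloor> = nat \<lfloor>ln (p' / \<mu>) / \<eta>\<rfloor>"
    using eq p p' by (auto simp: bucket_def)
  ultimately have "\<lfloor>ln (p / \<mu>) / \<eta>\<rfloor> = \<lfloor>ln (p' / \<mu>) / \<eta>\<rfloor>" by linarith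
  then have "ln (p / \<mu>) / \<eta> \<le> ln (p' / \<mu>) / \<eta> + 1" by linarith
  then have "ln (p / \<mu>) \<le> ln (p' / \<mu>) + \<eta>" using \<eta> by (simp add: field_simps)
  then have "ln p \<le> \<eta> + ln p'" using p p' \<mu> by (simp add: ln_div)
  then have "exp (ln p) \<le> exp (\<eta> + ln p')" by simp
  then show "p \<le> exp \<eta> * p'" using p p' \<mu> by (simp add: exp_add)
qed

lemma bucket_less:
  assumes "p \<le> 1" "0 < \<mu>" "0 < \<eta>"
  shows "bucket \<mu> \<eta> p < 2 + nat \<lfloor>ln (1 / \<mu>) / \<eta>\<rfloor>"
proof (cases "p < \<mu>")
  case False
  then have "ln (p / \<mu>) / \<eta> \<le> ln (1 / \<mu>) / \<eta>"
    using assms by (intro divide_right_mono) (auto simp: divide_right_mono)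
  then have "nat \<lfloor>ln (p / \<mu>) / \<eta>\<rfloor> \<le> nat \<lfloor>ln (1 / \<mu>) / \<eta>\<rfloor>" by (intro nat_mono floor_mono)
  then show ?thesis using False by (simp add: bucket_def)
qed (simp add: bucket_def)

text \<open>The restriction makes signatures agree outside the relevant entries, so that equality is
  meaningful and the range is finite.\<close>

definition signature :: "('q::finite, 'g::finite, 'a) ptm \<Rightarrow> ('q, 'g) mem set \<Rightarrow> nat \<Rightarrow> real \<Rightarrow> real \<Rightarrow>
    'a list \<Rightarrow> ('q, 'g) mem option \<times> ('q, 'g) mem outcome \<Rightarrow> nat" where
  "signature M G t \<mu> \<eta> w =
     restrict (\<lambda>(i, r). bucket \<mu> \<eta> (left_run M G w t i r)) (chain_rows G \<times> outcomes G)"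

lemma card_signature:
  assumes G: "finite G" and "0 < \<mu>" "0 < \<eta>"
  shows "finite (range (signature M G t \<mu> \<eta>))"
    "card (range (signature M G t \<mu> \<eta>)) \<le>
      (2 + nat \<lfloor>ln (1 / \<mu>) / \<eta>\<rfloor>) ^ ((card G + 1) * (card G + 3))"
proof -
  let ?D = "chain_rows G \<times> outcomes G" and ?B = "{..<2 + nat \<lfloor>ln (1 / \<mu>) / \<eta>\<rfloor>}"
  have D: "finite ?D" using G by (simp add: chain_rows_def)
  have le1: "left_run M G w t i r \<le> 1" if "r \<in> outcomes G" for w i r
  proof -
    have "distribution_on (outcomes G) (left_run M G w t i)"
      unfolding left_run_def by (rule distribution_seg[OF G])
    then show ?thesis unfolding distribution_on_def
      using member_le_sum[of r "outcomes G" "left_run M G w t i"] that by auto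
  qed
  have sub: "range (signature M G t \<mu> \<eta>) \<subseteq> PiE ?D (\<lambda>_. ?B)"
  proof (rule image_subsetI)
    fix w
    show "signature M G t \<mu> \<eta> w \<in> PiE ?D (\<lambda>_. ?B)"
      unfolding signature_def restrict_PiE_iff 
      using bucket_less[OF le1 assms(2,3)] by auto
  qed
  have fin: "finite (PiE ?D (\<lambda>_. ?B))" using D by (intro finite_PiE) auto
  show "finite (range (signature M G t \<mu> \<eta>))" by (rule finite_subset[OF sub fin])
  have "card (range (signature M G t \<mu> \<eta>)) \<le> card (PiE ?D (\<lambda>_. ?B))"
    by (rule card_mono[OF fin sub])
  also have "\<dots> = (2 + nat \<lfloor>ln (1 / \<mu>) / \<eta>\<rfloor>) ^ ((card G + 1) * (card G + 3))"
    using D by (simp add: card_PiE card_cartesian_product card_chain_rows[OF G] card_outcomes[OF G])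
  finally show "card (range (signature M G t \<mu> \<eta>)) \<le>
      (2 + nat \<lfloor>ln (1 / \<mu>) / \<eta>\<rfloor>) ^ ((card G + 1) * (card G + 3))" .
qed

text \<open>Having the same continuations up to a length bound need not be transitive. Equality of
  values of \<open>f\<close> is, and this gives genuine classes.\<close>

definition similarity_upto :: "'a list set \<Rightarrow> nat \<Rightarrow> ('a list \<Rightarrow> 'b) \<Rightarrow> bool" where
  "similarity_upto L n f \<longleftrightarrow> (\<forall>w w' v. f w = f w' \<longrightarrow> length (w @ v) \<le> n \<longrightarrow>
     length (w' @ v) \<le> n \<longrightarrow> w @ v \<in> L \<longrightarrow> w' @ v \<in> L)"

text \<open>Budget of the gap, with \<open>\<gamma> = 1 / 2 - \<epsilon>\<close> and hence
  \<open>1 - \<epsilon> = 1 / 2 + \<gamma>\<close>. Halting after time \<open>t\<close> costs at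
  most \<gamma>/4 by Markov. Truncation over \<open>t + 1\<close> rounds with
  \<open>card G + 3\<close> outcomes costs \<gamma>/4. The remaining \<gamma>/2 pays for rounding:
  \<open>card G + 1\<close> rows at exponent 4 give the factor
  \<open>exp (\<gamma> / 2)\<close>.\<close>

lemma signature_similarity:
  fixes M :: "('q::finite, 'g::finite, 'a::finite) ptm"
  assumes M: "is_ptm M" and \<epsilon>: "0 \<le> \<epsilon>" "\<epsilon> < 1 / 2"
    and acc: "\<And>w. w \<in> L \<Longrightarrow> 1 - \<epsilon> \<le> accept_prob M w"
    and rej: "\<And>w. w \<notin> L \<Longrightarrow> 1 - \<epsilon> \<le> reject_prob M w"
    and space: "\<And>w. length w \<le> n \<Longrightarrow> \<exists>s\<le>real N. runs_within_space M w s"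
    and time: "\<And>w. length w \<le> n \<Longrightarrow> cond_expected_time M w \<le> ennreal \<tau>"
    and \<tau>: "0 \<le> \<tau>" and t0: "0 < t" "4 * \<tau> / (1 / 2 - \<epsilon>) \<le> real t"
  defines "G \<equiv> bounded_mem M N"
  shows "similarity_upto L n (signature M G (Suc t)
    ((1 / 2 - \<epsilon>) / (4 * real (t + 1) * real (card G + 3))) ((1 / 2 - \<epsilon>) / (8 * real (card G + 1))))"
  unfolding similarity_upto_def
proof (intro allI impI)
  define \<gamma> where "\<gamma> = 1 / 2 - \<epsilon>"
  define \<mu> where "\<mu> = \<gamma> / (4 * real (t + 1) * real (card G + 3))"
  define \<eta> where "\<eta> = \<gamma> / (8 * real (card G + 1))"
  have \<gamma>: "0 < \<gamma>" "\<gamma> \<le> 1 / 2" using \<epsilon> by (auto simp: \<gamma>_def)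
  have \<mu>: "0 < \<mu>" using \<gamma> by (simp add: \<mu>_def)
  have \<eta>: "0 < \<eta>" using \<gamma> by (simp add: \<eta>_def)
  have G: "finite G" unfolding G_def by (rule bounded_mem_card)
  have cO: "card (outcomes G) = card G + 3" by (rule card_outcomes[OF G])
  have \<mu>O: "real (Suc t) * real (card (outcomes G)) * \<mu> = \<gamma> / 4"
  proof -
    have "a * b * (\<gamma> / (4 * a * b)) = \<gamma> / 4" if "0 < a" "0 < b" for a b :: real
      using that by (simp add: field_simps)
    from this[of "real (t + 1)" "real (card G + 3)"] show ?thesis unfolding cO \<mu>_def by simp
  qed
  have reach: "mem (last cs) \<in> G" if "computation M w cs" "length w \<le> n" for w cs
    using computation_in_bounded_mem that space unfolding G_def by blast
  have hit_ge: "1 / 2 + \<gamma> / 2 + real (Suc t * card (outcomes G)) * \<mu> \<le>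
      hit M G (input_tape w) S (Suc t) (init_config M)"
    if w: "length w \<le> n" and S: "S \<subseteq> halting_states M" and p: "1 - \<epsilon> \<le> (SUP t. prob_in_by M w S t)" for w S
  proof -
    \<comment> \<open>Recognition makes the halting probability positive, which conditioning on
      halting requires.\<close>
    have "(SUP t. prob_in_by M w S t) \<le> halt_prob M w"
      unfolding halt_prob_def using S
      by (intro cSUP_mono prob_in_by_SUP)
        (auto simp: prob_in_by_def intro!: exI measure_pmf.finite_measure_mono)
    then have "0 < halt_prob M w" using p \<epsilon> by linarith
    then have "1 - \<epsilon> \<le> prob_in_by M w S t + \<tau> / real t"
      using prob_in_by_late[OF S _ time[OF w] \<tau> t0(1)] p by linarith
    moreover have "\<tau> / real t \<le> \<gamma> / 4" using t0 \<gamma> by (simp add: \<gamma>_def[symmetric] field_simps)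
    moreover have "prob_in_by M w S t = hit M G (input_tape w) S (Suc t) (init_config M)"
      using reach[OF _ w] S by (intro prob_in_by_eq_hit) auto
    moreover have "real (Suc t * card (outcomes G)) * \<mu> = \<gamma> / 4" using \<mu>O by (simp only: of_nat_mult)
    ultimately show ?thesis unfolding \<gamma>_def by argo
  qed
  fix w w' v
  assume "signature M G (Suc t) ((1 / 2 - \<epsilon>) / (4 * real (t + 1) * real (card G + 3)))
      ((1 / 2 - \<epsilon>) / (8 * real (card G + 1))) w =
    signature M G (Suc t) ((1 / 2 - \<epsilon>) / (4 * real (t + 1) * real (card G + 3)))
      ((1 / 2 - \<epsilon>) / (8 * real (card G + 1))) w'"
  then have "signature M G (Suc t) \<mu> \<eta> w = signature M G (Suc t) \<mu> \<eta> w'"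
    by (simp only: \<mu>_def \<eta>_def \<gamma>_def)
  note sig_eq = fun_cong[OF this]
  have sig: "bucket \<mu> \<eta> (left_run M G w (Suc t) i r) = bucket \<mu> \<eta> (left_run M G w' (Suc t) i r)"
    if "i \<in> chain_rows G" "r \<in> outcomes G" for i r
    using sig_eq[of "(i, r)"] that by (simp add: signature_def)
  assume len: "length (w @ v) \<le> n" "length (w' @ v) \<le> n" and wv: "w @ v \<in> L"
  show "w' @ v \<in> L"
  proof (rule ccontr)
    assume w'v: "w' @ v \<notin> L"
    let ?A = "right_reward M G v (Suc t) {accept_state M}"
    let ?R = "right_reward M G v (Suc t) {reject_state M}"
    let ?chain = "\<lambda>w A. chain_iter (chain_rows G) (round_kernel (outcomes G) (left_run M G w (Suc t))
      (right_goto M G v (Suc t))) (round_reward (outcomes G) (left_run M G w (Suc t)) A) (Suc t) None"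
    have None: "None \<in> chain_rows G" by (simp add: chain_rows_def)
    have nonneg: "0 \<le> right_reward M G v (Suc t) S r" for S r
      by (auto simp: right_reward_def halt_reward_def right_run_def seg_nonneg simp del: seg.simps
          split: outcome.splits intro!: add_nonneg_nonneg)
    have d: "distribution_on (outcomes G) (left_run M G w (Suc t) i)" for w i
      unfolding left_run_def by (rule distribution_seg[OF G])
    have c1: "1 / 2 + \<gamma> / 2 + real (Suc t * card (outcomes G)) * \<mu> \<le> ?chain w ?A"
      using hit_ge[OF len(1), of "{accept_state M}"] acc[OF wv]
        hit_le_rounds[where t = "Suc t" and w = w and v = v and S = "{accept_state M}",
            OF M G order_refl None]
      by (simp only: accept_prob_def row_start.simps halting_states_def) auto
    have c2: "1 / 2 + \<gamma> / 2 + real (Suc t * card (outcomes G)) * \<mu> \<le> ?chain w' ?R"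
      using hit_ge[OF len(2), of "{reject_state M}"] rej[OF w'v]
        hit_le_rounds[where t = "Suc t" and w = w' and v = v and S = "{reject_state M}",
            OF M G order_refl None]
      by (simp only: reject_prob_def row_start.simps halting_states_def) auto
    have c3: "\<mu> * real (card (outcomes G)) \<le> 1 / 2"
    proof -
      have "1 * (real (card (outcomes G)) * \<mu>) \<le> real (Suc t) * (real (card (outcomes G)) * \<mu>)"
        using \<mu> by (intro mult_right_mono) auto
      then show ?thesis using \<mu>O \<gamma> by (simp add: mult_ac)
    qed
    have c4: "exp \<eta> ^ (4 * card (chain_rows G)) \<le> exp (\<gamma> / 2)"
      unfolding exp_of_nat_mult[symmetric] card_chain_rows[OF G] by (simp add: \<eta>_def field_simps)
    have c5: "left_run M G w (Suc t) i r < \<mu> \<longleftrightarrow> left_run M G w' (Suc t) i r < \<mu>"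
      if "i \<in> chain_rows G" "r \<in> outcomes G" for i r
      using bucket_eqD(1)[OF sig[OF that] \<mu> \<eta>] .
    have c6: "left_run M G w (Suc t) i r \<le> exp \<eta> * left_run M G w' (Suc t) i r \<and>
        left_run M G w' (Suc t) i r \<le> exp \<eta> * left_run M G w (Suc t) i r"
      if "i \<in> chain_rows G" "r \<in> outcomes G" "\<mu> \<le> left_run M G w (Suc t) i r" for i r
      using bucket_eqD[OF sig[OF that(1,2)] \<mu> \<eta>] bucket_eqD(2)[OF sig[OF that(1,2), symmetric] \<mu> \<eta>]
        that(3) by auto
    show False
      by (rule close_systems_agree[where P = "left_run M G w (Suc t)" and P' = "left_run M G w' (Suc t)"
            and \<beta> = "exp \<eta>" and \<delta> = "\<gamma> / 2" and m = "Suc t",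
            OF outcome_ok_right[OF G M] nonneg nonneg d d \<mu> c3 None _ c5 c6 c4 _ _ c1 c2])
        (use \<gamma> \<eta> in auto)
  qed
qed

section \<open>From bounded similarity to a single automaton\<close>

section \<open>Automata from similarity classes\<close>

lemma foldl_in_states:
  "q \<in> Q \<Longrightarrow> \<forall>q\<in>Q. \<forall>a. \<delta> q a \<in> Q \<Longrightarrow> foldl \<delta> q w \<in> Q"
  by (induction w arbitrary: q) auto

text \<open>Moves a finite state set of any type into the natural numbers along an injection, as
  \<open>regular_lang\<close> asks for.\<close>

lemma regular_langI:
  fixes Q :: "'s set"
  assumes "finite Q" "q0 \<in> Q" "\<forall>q\<in>Q. \<forall>a. \<delta> q a \<in> Q" and L: "L = {w. foldl \<delta> q0 w \<in> F}"
  shows "regular_lang L"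
proof -
  obtain f :: "'s \<Rightarrow> nat" where f: "inj_on f Q"
    using finite_imp_inj_to_nat_seg[OF assms(1)] by blast
  define \<delta>' where "\<delta>' m a = f (\<delta> (the_inv_into Q f m) a)" for m a
  have \<delta>': "\<delta>' (f q) a = f (\<delta> q a)" if "q \<in> Q" for q a
    using that f by (simp add: \<delta>'_def the_inv_into_f_f)
  have run: "foldl \<delta>' (f q) w = f (foldl \<delta> q w)" if "q \<in> Q" for q w
    using that assms(3) by (induction w arbitrary: q) (simp_all add: \<delta>')
  have "w \<in> L \<longleftrightarrow> foldl \<delta>' (f q0) w \<in> f ` (F \<inter> Q)" for w
    using f foldl_in_states[OF assms(2,3), of w] unfolding run[OF assms(2)] L
    by (auto dest: inj_onD)
  then show ?thesis unfolding regular_lang_def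
    by (intro exI[of _ "f ` Q"] exI[of _ \<delta>'] exI[of _ "f q0"] exI[of _ "f ` (F \<inter> Q)"])
      (use assms in \<open>auto simp: \<delta>'\<close>)
qed

text \<open>A word longer than the number of state pairs repeats a pair in the product automaton.
  Cutting out that loop gives a shorter word with the same final states in both.\<close>

lemma dfa_equivalence:
  assumes Q: "finite Q" "q0 \<in> Q" "\<forall>q\<in>Q. \<forall>a. \<delta> q a \<in> Q"
    and Q': "finite Q'" "q0' \<in> Q'" "\<forall>q\<in>Q'. \<forall>a. \<delta>' q a \<in> Q'"
    and card: "card Q * card Q' \<le> n"
    and agree: "\<And>w. length w \<le> n \<Longrightarrow> foldl \<delta> q0 w \<in> F \<longleftrightarrow> foldl \<delta>' q0' w \<in> F'"
  shows "foldl \<delta> q0 w \<in> F \<longleftrightarrow> foldl \<delta>' q0' w \<in> F'"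
proof (induction w rule: length_induct)
  case (1 w)
  show ?case
  proof (cases "length w \<le> n")
    case False
    define st where "st i = (foldl \<delta> q0 (take i w), foldl \<delta>' q0' (take i w))" for i
    have "st ` {..length w} \<subseteq> Q \<times> Q'"
      unfolding st_def using foldl_in_states[OF Q(2,3)] foldl_in_states[OF Q'(2,3)] by auto
    then have "card (st ` {..length w}) \<le> card (Q \<times> Q')"
      using Q(1) Q'(1) by (intro card_mono) auto
    also have "\<dots> < card {..length w}" using card False by (simp add: card_cartesian_product)
    finally have "\<not> inj_on st {..length w}" by (rule pigeonhole)
    then obtain i j where ij: "i < j" "j \<le> length w" "st i = st j"
      by (auto simp: inj_on_def) (metis nat_neq_iff)
    define w' where "w' = take i w @ drop j w"
    have "length w' < length w" using ij by (simp add: w'_def)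
    moreover have "foldl \<delta> q0 w' = foldl \<delta> q0 (take j w @ drop j w)"
      "foldl \<delta>' q0' w' = foldl \<delta>' q0' (take j w @ drop j w)"
      using ij(3) by (simp_all add: w'_def st_def del: append_take_drop_id)
    ultimately show ?thesis using 1[rule_format, of w'] by simp
  qed (use agree in simp)
qed

text \<open>The states are representatives of minimal length, so that reading a word never leads
  to a representative longer than the part read so far.\<close>

lemma dfa_of_similarity:
  fixes f :: "'a list \<Rightarrow> 'b"
  assumes sim: "\<And>w w' v. f w = f w' \<Longrightarrow> length (w @ v) \<le> n \<Longrightarrow> length (w' @ v) \<le> n \<Longrightarrow>
      w @ v \<in> L \<Longrightarrow> w' @ v \<in> L"
    and fin: "finite (range f)"
  obtains Q :: "'a list set" and \<delta> q0 where "finite Q" "q0 \<in> Q" "\<forall>q\<in>Q. \<forall>a. \<delta> q a \<in> Q"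
    "card Q \<le> card (range f)" "\<And>w. length w \<le> n \<Longrightarrow> foldl \<delta> q0 w \<in> L \<longleftrightarrow> w \<in> L"
proof -
  define pick where "pick y = arg_min length (\<lambda>w. f w = y)" for y
  define rep where "rep w = pick (f w)" for w
  have rep: "f (rep w) = f w" "length (rep w) \<le> length w" for w
    using arg_min_nat_lemma[of "\<lambda>w'. f w' = f w" w length] by (auto simp: rep_def pick_def)
  define \<delta> where "\<delta> q a = rep (q @ [a])" for q a
  have run: "foldl \<delta> q (w @ [a]) = rep (foldl \<delta> q w @ [a])" for q w a
    unfolding foldl_append foldl.simps by (simp only: \<delta>_def)
  have range: "range rep = pick ` range f" by (auto simp: rep_def)
  have len: "length (foldl \<delta> (rep []) w) \<le> length w" for w
  proof (induction w rule: rev_induct)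
    case (snoc a w)
    then show ?case using rep(2)[of "foldl \<delta> (rep []) w @ [a]"]
      by (simp add: run del: foldl_append)
  qed (use rep(2)[of "[]"] in simp)
  have inv: "foldl \<delta> (rep []) w @ v \<in> L \<longleftrightarrow> w @ v \<in> L" if "length (w @ v) \<le> n" for w v
    using that
  proof (induction w arbitrary: v rule: rev_induct)
    case Nil
    then show ?case using sim[of "rep []" "[]" v] sim[of "[]" "rep []" v] rep[of "[]"] by auto
  next
    case (snoc a w)
    let ?q = "foldl \<delta> (rep []) w @ [a]"
    have "?q @ v \<in> L \<longleftrightarrow> (w @ [a]) @ v \<in> L" using snoc.IH[of "a # v"] snoc.prems by simp
    moreover have "rep ?q @ v \<in> L \<longleftrightarrow> ?q @ v \<in> L"
    proof -
      have "length (?q @ v) \<le> n" using snoc.prems len[of w] by simp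
      moreover have "length (rep ?q @ v) \<le> length (?q @ v)" using rep(2)[of ?q] by simp
      ultimately show ?thesis
        using sim[OF rep(1)[of ?q], of v] sim[OF rep(1)[of ?q, symmetric], of v] by linarith
    qed
    ultimately show ?case by (simp add: run del: foldl_append)
  qed
  show ?thesis
  proof (rule that[of "range rep" "rep []" \<delta>])
    show "finite (range rep)" "card (range rep) \<le> card (range f)"
      unfolding range using fin by (auto intro: card_image_le)
    show "foldl \<delta> (rep []) w \<in> L \<longleftrightarrow> w \<in> L" if "length w \<le> n" for w
      using inv[of w "[]"] that by simp
  qed (auto simp: \<delta>_def)
qed

text \<open>Karp's argument: automata that are correct up to n and n + 1 agree up to n, hence
  everywhere when they are small.\<close>

lemma regular_if_few_classes:
  fixes f :: "nat \<Rightarrow> 'a list \<Rightarrow> 'b"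
  assumes sim: "\<And>n w w' v. n0 \<le> n \<Longrightarrow> f n w = f n w' \<Longrightarrow> length (w @ v) \<le> n \<Longrightarrow>
      length (w' @ v) \<le> n \<Longrightarrow> w @ v \<in> L \<Longrightarrow> w' @ v \<in> L"
    and fin: "\<And>n. n0 \<le> n \<Longrightarrow> finite (range (f n))"
    and card: "\<And>n. n0 \<le> n \<Longrightarrow> (card (range (f n)))\<^sup>2 \<le> n"
  shows "regular_lang L"
proof -
  have "\<forall>n. \<exists>A :: 'a list set \<times> ('a list \<Rightarrow> 'a \<Rightarrow> 'a list) \<times> 'a list. n0 \<le> n \<longrightarrow>
    (case A of (Q, \<delta>, q0) \<Rightarrow> finite Q \<and> q0 \<in> Q \<and> (\<forall>q\<in>Q. \<forall>a. \<delta> q a \<in> Q) \<and> (card Q)\<^sup>2 \<le> n \<and>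
      (\<forall>w. length w \<le> n \<longrightarrow> (foldl \<delta> q0 w \<in> L \<longleftrightarrow> w \<in> L)))"
  proof
    fix n
    show "\<exists>A :: 'a list set \<times> ('a list \<Rightarrow> 'a \<Rightarrow> 'a list) \<times> 'a list. n0 \<le> n \<longrightarrow>
      (case A of (Q, \<delta>, q0) \<Rightarrow> finite Q \<and> q0 \<in> Q \<and> (\<forall>q\<in>Q. \<forall>a. \<delta> q a \<in> Q) \<and> (card Q)\<^sup>2 \<le> n \<and>
        (\<forall>w. length w \<le> n \<longrightarrow> (foldl \<delta> q0 w \<in> L \<longleftrightarrow> w \<in> L)))"
    proof (cases "n0 \<le> n")
      case True
      show ?thesis
      proof (rule dfa_of_similarity[of "f n" n L])
        show "w' @ v \<in> L" if "f n w = f n w'" "length (w @ v) \<le> n" "length (w' @ v) \<le> n" "w @ v \<in> L"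
          for w w' v using sim[OF True that] .
        show "finite (range (f n))" by (rule fin[OF True])
        fix Q :: "'a list set" and \<delta> q0
        assume A: "finite Q" "q0 \<in> Q" "\<forall>q\<in>Q. \<forall>a. \<delta> q a \<in> Q"
          "card Q \<le> card (range (f n))" "\<And>w. length w \<le> n \<Longrightarrow> foldl \<delta> q0 w \<in> L \<longleftrightarrow> w \<in> L"
        have "(card Q)\<^sup>2 \<le> n" by (rule order_trans[OF power_mono[OF A(4)] card[OF True]]) simp
        with A(1-3,5) show ?thesis by (intro exI[of _ "(Q, \<delta>, q0)"]) (simp only: prod.case, blast)
      qed
    qed simp
  qed
  from choice[OF this] obtain A :: "nat \<Rightarrow> 'a list set \<times> ('a list \<Rightarrow> 'a \<Rightarrow> 'a list) \<times> 'a list"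
    where A: "\<forall>n. n0 \<le> n \<longrightarrow> (case A n of (Q, \<delta>, q0) \<Rightarrow> finite Q \<and> q0 \<in> Q \<and>
      (\<forall>q\<in>Q. \<forall>a. \<delta> q a \<in> Q) \<and> (card Q)\<^sup>2 \<le> n \<and>
      (\<forall>w. length w \<le> n \<longrightarrow> (foldl \<delta> q0 w \<in> L \<longleftrightarrow> w \<in> L)))" ..
  define Q where "Q n = fst (A n)" for n
  define \<delta> where "\<delta> n = fst (snd (A n))" for n
  define q where "q n = snd (snd (A n))" for n
  have dfa: "finite (Q n)" "q n \<in> Q n" "\<forall>p\<in>Q n. \<forall>a. \<delta> n p a \<in> Q n" "(card (Q n))\<^sup>2 \<le> n"
    "\<And>w. length w \<le> n \<Longrightarrow> foldl (\<delta> n) (q n) w \<in> L \<longleftrightarrow> w \<in> L" if "n0 \<le> n" for n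
    using A[THEN spec, THEN mp, OF that] by (auto simp: Q_def \<delta>_def q_def split: prod.splits)
  have consecutive: "foldl (\<delta> n) (q n) w \<in> L \<longleftrightarrow> foldl (\<delta> (Suc n)) (q (Suc n)) w \<in> L" if n: "n0 \<le> n" for n w
  proof (rule dfa_equivalence[where n = n])
    \<comment> \<open>The reason for comparing class counts with the square root of n: since
      \<open>n * Suc n\<close> lies below the next square, the product automaton of two consecutive
      machines has at most \<open>n\<close> states.\<close>
    have "(card (Q n) * card (Q (Suc n)))\<^sup>2 \<le> n * Suc n"
      unfolding power_mult_distrib using n by (intro mult_mono dfa) auto
    also have "\<dots> < (Suc n)\<^sup>2" by (simp add: power2_eq_square)
    finally show "card (Q n) * card (Q (Suc n)) \<le> n"
      using power_less_imp_less_base[of "card (Q n) * card (Q (Suc n))" 2 "Suc n"] by linarith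
    show "foldl (\<delta> n) (q n) w \<in> L \<longleftrightarrow> foldl (\<delta> (Suc n)) (q (Suc n)) w \<in> L" if "length w \<le> n" for w
      using dfa(5)[OF n that] dfa(5)[of "Suc n" w] n that by simp
  qed (use dfa(1-3) n in auto)
  have const: "foldl (\<delta> n) (q n) w \<in> L \<longleftrightarrow> foldl (\<delta> n0) (q n0) w \<in> L" if "n0 \<le> n" for n w
    using that
  proof (induction n rule: dec_induct)
    case (step m)
    then show ?case using consecutive[of m w] by blast
  qed simp
  have "w \<in> L \<longleftrightarrow> foldl (\<delta> n0) (q n0) w \<in> L" for w
    using dfa(5)[of "max n0 (length w)" w] const[of "max n0 (length w)" w] by simp
  then have "L = {w. foldl (\<delta> n0) (q n0) w \<in> L}" by blast
  then show ?thesis by (rule regular_langI[OF dfa(1-3)[OF order_refl]])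
qed

section \<open>Asymptotic counting and the conclusion\<close>

section \<open>Growth rates\<close>

text \<open>Inputs of all lengths up to \<open>n\<close> matter, and neither space nor time is
  assumed monotone. The finitely many exceptional values of \<open>f\<close> have a maximum, which
  \<open>g\<close> eventually exceeds.\<close>

lemma running_bound:
  fixes f g :: "nat \<Rightarrow> real"
  assumes fg: "\<forall>\<^sub>F n in sequentially. f n \<le> g n" and lim: "filterlim g at_top sequentially"
    and mono: "\<And>m n. k \<le> m \<Longrightarrow> m \<le> n \<Longrightarrow> g m \<le> g n"
  shows "\<forall>\<^sub>F n in sequentially. \<forall>m\<le>n. f m \<le> g n"
proof -
  obtain m0 where m0: "\<And>m. m0 \<le> m \<Longrightarrow> f m \<le> g m" using fg by (auto simp: eventually_sequentially)
  define K where "K = Max (f ` {..max m0 k})"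
  have "\<forall>\<^sub>F n in sequentially. K \<le> g n" using lim by (simp add: filterlim_at_top)
  then show ?thesis
  proof (rule eventually_mono, intro allI impI)
    fix n m assume K: "K \<le> g n" and "m \<le> n"
    show "f m \<le> g n"
    proof (cases "m \<le> max m0 k")
      case True
      then have "f m \<le> K" unfolding K_def by (intro Max_ge) auto
      then show ?thesis using K by simp
    next
      case False
      then have "f m \<le> g m" "g m \<le> g n" using m0 mono \<open>m \<le> n\<close> by auto
      then show ?thesis by simp
    qed
  qed
qed

lemma poly_le_power:
  fixes p :: "real poly"
  assumes "1 \<le> x"
  shows "poly p x \<le> (1 + (\<Sum>i\<le>degree p. \<bar>coeff p i\<bar>)) * x ^ Suc (degree p)"
proof -
  have "poly p x = (\<Sum>i\<le>degree p. coeff p i * x ^ i)" by (rule poly_altdef)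
  also have "\<dots> \<le> (\<Sum>i\<le>degree p. \<bar>coeff p i\<bar> * x ^ Suc (degree p))"
    using assms by (intro sum_mono mult_mono power_increasing) auto
  also have "\<dots> = (\<Sum>i\<le>degree p. \<bar>coeff p i\<bar>) * x ^ Suc (degree p)"
    by (simp only: sum_distrib_right)
  also have "\<dots> \<le> (1 + (\<Sum>i\<le>degree p. \<bar>coeff p i\<bar>)) * x ^ Suc (degree p)"
    using assms by (intro mult_right_mono) auto
  finally show ?thesis .
qed

text \<open>Here \<open>x\<close> stands for log n, \<open>x powr \<theta>\<close> bounds the number
  of memories, and \<open>2 powr (x powr b)\<close> is the binary logarithm of the time bound. The
  left-hand side bounds the number of buckets.\<close>

lemma eventually_bucket_count_le:
  fixes b \<theta> \<gamma> K :: real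
  assumes "0 < b" "0 < \<theta>" "\<theta> < b" "0 < \<gamma>"
  shows "\<forall>\<^sub>F x in at_top. 2 + 8 / \<gamma> * x powr \<theta> * (K + 2 powr (x powr b) + x powr \<theta>) \<le> 2 powr (2 * x powr b)"
  using assms by real_asymp

lemma eventually_powr_exponent_le:
  fixes b \<theta> :: real
  assumes "0 < b" "0 < \<theta>" "b + 2 * \<theta> < 1"
  shows "\<forall>\<^sub>F x in at_top. 4 * x powr (b + 2 * \<theta>) \<le> x"
  using assms by real_asymp

lemma eventually_memory_count_le:
  fixes C \<theta> :: real
  assumes "0 < \<theta>" "0 < C"
  shows "\<forall>\<^sub>F x in at_top. C\<^sup>2 * x powr (\<theta> / 2) \<le> x powr \<theta>"
  using assms by real_asymp

lemma eventually_log_linear_less: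
  fixes c k :: real
  assumes "0 < k"
  shows "\<forall>\<^sub>F x in at_top. log 2 (c + k * x) < x powr (1 / 2)"
  using assms by real_asymp

lemma time_bound_at_top:
  assumes "0 < (b::real)"
  shows "filterlim (\<lambda>n. 2 powr (2 powr (log 2 (real n) powr b))) at_top sequentially"
proof -
  have "filterlim (\<lambda>x. x powr b) at_top at_top" using assms by real_asymp
  then have "filterlim (\<lambda>n. log 2 (real n) powr b) at_top sequentially"
    by (rule filterlim_compose) real_asymp
  moreover have "filterlim (\<lambda>x::real. 2 powr (2 powr x)) at_top at_top" by real_asymp
  ultimately show ?thesis by (rule filterlim_compose[rotated])
qed

text \<open>The polynomial factor is absorbed so that a single exponential in \<open>N\<close>
  remains. With \<open>N\<close> about a small multiple of log log n it becomes a small power of log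
  n.\<close>

lemma card_bounded_mem_le:
  fixes M :: "('q::finite, 'g::finite, 'a::finite) ptm"
  shows "card (bounded_mem M N) + 3 \<le> (3 * card (UNIV :: 'q set) * card (UNIV :: 'g set) ^ 2 + 3) ^ (N + 1)"
proof -
  let ?q = "card (UNIV :: 'q set)" and ?g = "card (UNIV :: 'g set)"
  have g: "1 \<le> ?g" and q: "1 \<le> ?q" by (simp_all add: Suc_le_eq card_gt_0_iff)
  have three: "2 * N + 1 \<le> 3 ^ (N + 1)" by (induction N) auto
  have "card (bounded_mem M N) \<le> ?q * (?g ^ (2 * N + 1) * (2 * N + 1))" by (rule bounded_mem_card(2))
  also have "\<dots> \<le> ?q ^ (N + 1) * ((?g ^ 2) ^ (N + 1) * 3 ^ (N + 1))"
  proof (intro mult_mono three)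
    show "?q \<le> ?q ^ (N + 1)" using q by (intro self_le_power) auto
    show "?g ^ (2 * N + 1) \<le> (?g ^ 2) ^ (N + 1)"
      unfolding power_mult[symmetric] using g by (intro power_increasing) auto
  qed auto
  also have "\<dots> = (3 * ?q * ?g ^ 2) ^ (N + 1)" by (simp add: power_mult_distrib mult_ac)
  also have "(3 * ?q * ?g ^ 2) ^ (N + 1) + 3 \<le> (3 * ?q * ?g ^ 2 + 3) ^ (N + 1)"
  proof -
    have "x ^ (N + 1) + 3 \<le> (x + 3) ^ (N + 1)" for x :: nat
    proof (induction N)
      case (Suc N)
      have "x ^ (Suc N + 1) + 3 \<le> (x ^ (N + 1) + 3) * (x + 3)" by (simp add: algebra_simps)
      also have "\<dots> \<le> (x + 3) ^ (N + 1) * (x + 3)" using Suc by (intro mult_right_mono) auto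
      finally show ?case by (simp add: mult_ac)
    qed simp
    then show ?thesis .
  qed
  finally show ?thesis by simp
qed

lemma mono_time_bound:
  assumes "0 < (b::real)" "1 \<le> m" "m \<le> n"
  shows "2 powr (2 powr (log 2 (real m) powr b)) \<le> 2 powr (2 powr (log 2 (real n) powr b))"
  using assms by (intro powr_mono powr_mono2) auto

text \<open>With \<open>l\<close> = log n, the base \<open>B\<close> is at most
  \<open>2 powr (2 * l powr b)\<close> and the exponent \<open>(C + 1) * (C + 3)\<close> is at most
  \<open>l powr (2 * \<theta>)\<close>. Squaring yields
  \<open>2 powr (4 * l powr (b + 2 * \<theta>))\<close>, which stays below n since the total
  exponent of \<open>l\<close> is less than 1.\<close>

lemma signature_count_le:
  fixes \<gamma> \<tau> \<theta> b c l :: real and B t C :: nat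
  assumes \<gamma>: "0 < \<gamma>" and \<tau>: "\<tau> = 2 powr (2 powr (l powr b))" and t: "real t \<le> 4 * \<tau> / \<gamma> + 2"
    and C: "real C + 3 \<le> l powr \<theta>" and l: "0 < l"
    and B: "real B \<le> 2 + ln (1 / (\<gamma> / (4 * real (t + 1) * real (C + 3)))) / (\<gamma> / (8 * real (C + 1)))"
    and 1: "2 + 8 / \<gamma> * l powr \<theta> * (ln (4 / \<gamma> * (4 / \<gamma> + 3)) + 2 powr (l powr b) + l powr \<theta>) \<le> 2 powr (2 * l powr b)"
    and 2: "4 * l powr (b + 2 * \<theta>) \<le> l"
    and nn: "0 \<le> ln (4 / \<gamma> * (4 / \<gamma> + 3))" 
  shows "real ((B ^ ((C + 1) * (C + 3)))\<^sup>2) \<le> 2 powr l"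
proof -
  have \<tau>1: "1 \<le> \<tau>" unfolding \<tau> by (intro ge_one_powr_ge_zero) auto
  let ?x = "4 / \<gamma> * (real (t + 1) * real (C + 3))"
  have "real (t + 1) \<le> (4 / \<gamma> + 3) * \<tau>"
  proof -
    have "real (t + 1) \<le> 4 / \<gamma> * \<tau> + 3 * 1" using t by simp
    also have "\<dots> \<le> 4 / \<gamma> * \<tau> + 3 * \<tau>" using \<tau>1 by (intro add_left_mono mult_left_mono) auto
    finally show ?thesis by (simp add: algebra_simps)
  qed
  then have "4 / \<gamma> * (real (t + 1) * real (C + 3)) \<le> 4 / \<gamma> * (((4 / \<gamma> + 3) * \<tau>) * l powr \<theta>)"
    using C \<gamma> \<tau>1 by (intro mult_left_mono mult_mono) auto
  then have x: "?x \<le> 4 / \<gamma> * (4 / \<gamma> + 3) * \<tau> * l powr \<theta>" by (simp only: mult.assoc)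
  have x0: "0 < ?x" using \<gamma> by simp
  have k0: "0 < 4 / \<gamma> * (4 / \<gamma> + 3)" using \<gamma> by (intro mult_pos_pos add_pos_pos) auto
  have "ln ?x \<le> ln (4 / \<gamma> * (4 / \<gamma> + 3) * \<tau> * l powr \<theta>)"
    using x x0 by (intro ln_mono) auto
  also have "\<dots> = ln (4 / \<gamma> * (4 / \<gamma> + 3)) + ln \<tau> + ln (l powr \<theta>)"
  proof -
    have "ln (x * y * z) = ln x + ln y + ln z" if "0 < x" "0 < y" "0 < z" for x y z :: real
      using that by (simp add: ln_mult_pos)
    from this[OF k0, of \<tau> "l powr \<theta>"] show ?thesis using \<tau>1 l by simp
  qed
  also have "ln \<tau> \<le> 2 powr (l powr b)"
  proof -
    have "ln \<tau> = 2 powr (l powr b) * ln 2" unfolding \<tau> by (simp add: ln_powr)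
    also have "\<dots> \<le> 2 powr (l powr b) * 1" using ln_2_less_1 by (intro mult_left_mono) auto
    finally show ?thesis by simp
  qed
  also have "ln (l powr \<theta>) \<le> l powr \<theta>" using l ln_bound[of "l powr \<theta>"] by simp
  finally have lnx: "ln ?x \<le> ln (4 / \<gamma> * (4 / \<gamma> + 3)) + 2 powr (l powr b) + l powr \<theta>" by simp
  have "real B \<le> 2 + 8 / \<gamma> * real (C + 1) * ln ?x"
  proof -
    have "1 / (\<gamma> / (4 * real (t + 1) * real (C + 3))) = ?x" by simp
    then show ?thesis using B by (simp only: divide_divide_eq_right times_divide_eq_left
          times_divide_eq_right mult.commute mult.left_commute)
  qed
  also have "\<dots> \<le> 2 + 8 / \<gamma> * real (C + 1) * (ln (4 / \<gamma> * (4 / \<gamma> + 3)) + 2 powr (l powr b) + l powr \<theta>)"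
    using lnx \<gamma> by (intro add_left_mono mult_left_mono) auto
  also have "\<dots> \<le> 2 + 8 / \<gamma> * l powr \<theta> * (ln (4 / \<gamma> * (4 / \<gamma> + 3)) + 2 powr (l powr b) + l powr \<theta>)"
    using C \<gamma> nn by (intro add_left_mono mult_right_mono mult_left_mono) auto
  also note 1
  finally have B2: "real B \<le> 2 powr (2 * l powr b)" .
  have "real ((B ^ ((C + 1) * (C + 3)))\<^sup>2) = real B ^ (2 * ((C + 1) * (C + 3)))"
    by (simp flip: power_mult add: mult.commute)
  also have "\<dots> \<le> (2 powr (2 * l powr b)) ^ (2 * ((C + 1) * (C + 3)))"
    using B2 by (intro power_mono) auto
  also have "\<dots> = 2 powr (4 * l powr b * (real (C + 1) * real (C + 3)))"
    by (subst powr_realpow[symmetric]) (simp_all add: powr_powr algebra_simps)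
  also have "\<dots> \<le> 2 powr (4 * l powr b * (l powr \<theta> * l powr \<theta>))"
    using C by (intro powr_mono mult_left_mono mult_mono) auto
  also have "4 * l powr b * (l powr \<theta> * l powr \<theta>) = 4 * l powr (b + 2 * \<theta>)"
    by (simp only: mult_2 powr_add mult.assoc)
  also have "2 powr (4 * l powr (b + 2 * \<theta>)) \<le> 2 powr l" using 2 by (intro powr_mono) auto
  finally show ?thesis .
qed

lemma regular_if_fast:
  fixes M :: "('q::finite, 'g::finite, 'a::finite) ptm" and s T :: "nat \<Rightarrow> real"
  assumes M: "is_ptm M" and rec: "recognizes M L"
    and s: "s \<in> o(\<lambda>n. log 2 (log 2 (real n)))"
    and space: "\<And>w. runs_within_space M w (s (length w))"
    and time: "\<And>w. cond_expected_time M w \<le> ennreal (T (length w))"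
    and b: "0 < b" "b < 1"
    and T: "\<forall>\<^sub>F n in sequentially. T n \<le> 2 powr (2 powr (log 2 (real n) powr b))"
  shows "regular_lang L"
proof -
  obtain \<epsilon> where \<epsilon>: "0 \<le> \<epsilon>" "\<epsilon> < 1 / 2" and acc: "\<And>w. w \<in> L \<Longrightarrow> 1 - \<epsilon> \<le> accept_prob M w"
    and rej: "\<And>w. w \<notin> L \<Longrightarrow> 1 - \<epsilon> \<le> reject_prob M w"
  proof -
    obtain \<epsilon> where "\<epsilon> < 1 / 2" "\<forall>w\<in>L. 1 - \<epsilon> \<le> accept_prob M w" "\<forall>w. w \<notin> L \<longrightarrow> 1 - \<epsilon> \<le> reject_prob M w"
      using rec by (auto simp: recognizes_def)
    \<comment> \<open>In \<open>recognizes\<close> a negative \<epsilon> is formally possible;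
      raising it to 0 only weakens the bounds.\<close>
    then show ?thesis by (intro that[of "max \<epsilon> 0"]) (fastforce simp: max_def)+
  qed
  define \<gamma> where "\<gamma> = 1 / 2 - \<epsilon>"
  have \<gamma>: "0 < \<gamma>" "\<gamma> \<le> 1 / 2" using \<epsilon> by (auto simp: \<gamma>_def)
  \<comment> \<open>Two factors \<open>l n powr \<theta>\<close> from the number of signature
    entries must fit between the exponents b and 1.\<close>
  define \<theta> where "\<theta> = min b (1 - b) / 4"
  have \<theta>: "0 < \<theta>" "\<theta> < b" "b + 2 * \<theta> < 1" using b by (auto simp: \<theta>_def min_def field_simps)
  define C where "C = 3 * card (UNIV :: 'q set) * card (UNIV :: 'g set) ^ 2 + 3"
  have C: "1 < real C" unfolding C_def of_nat_add
    by (intro less_le_trans[OF _ add_increasing[OF of_nat_0_le_iff order_refl]]) simp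
  \<comment> \<open>Chosen so that \<open>C powr (\<eta> * log 2 (l n))\<close> equals
    \<open>l n powr (\<theta> / 2)\<close>. The other half of \<theta> absorbs the factor
    \<open>C\<^sup>2\<close>, which stems from rounding \<open>N\<close> up and from the exponent
    \<open>N + 1\<close>. The little-o hypothesis is applied with this \<eta>.\<close>
  define \<eta> where "\<eta> = \<theta> / 2 / log 2 C"
  have \<eta>: "0 < \<eta>" using \<theta> C by (simp add: \<eta>_def)
  define l where "l n = log 2 (real n)" for n :: nat
  define N where "N n = nat \<lceil>\<eta> * log 2 (l n)\<rceil>" for n
  define \<tau> where "\<tau> n = 2 powr (2 powr (l n powr b))" for n
  \<comment> \<open>Large enough for Markov's inequality to leave at most \<gamma>/4; the summand 1
    makes it positive at once.\<close>
  define t where "t n = nat \<lceil>4 * \<tau> n / \<gamma>\<rceil> + 1" for n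
  define G where "G n = bounded_mem M (N n)" for n
  define \<mu> where "\<mu> n = \<gamma> / (4 * real (t n + 1) * real (card (G n) + 3))" for n
  define \<beta> where "\<beta> n = \<gamma> / (8 * real (card (G n) + 1))" for n
  define f where "f n = signature M (G n) (Suc (t n)) (\<mu> n) (\<beta> n)" for n
  have G: "finite (G n)" for n unfolding G_def by (rule bounded_mem_card)
  have \<mu>: "0 < \<mu> n" and \<beta>: "0 < \<beta> n" for n using \<gamma> by (simp_all add: \<mu>_def \<beta>_def)
  have \<tau>1: "1 \<le> \<tau> n" for n unfolding \<tau>_def by (intro ge_one_powr_ge_zero) auto

  have lim_l: "filterlim l at_top sequentially" unfolding l_def by real_asymp
  have sN: "\<forall>\<^sub>F n in sequentially. \<forall>m\<le>n. s m \<le> \<eta> * log 2 (l n)"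
  proof (rule running_bound[where k = 2])
    have "\<forall>\<^sub>F n in sequentially. norm (s n) \<le> \<eta> * norm (log 2 (log 2 (real n)))"
      using landau_o.smallD[OF s \<eta>] .
    moreover have "\<forall>\<^sub>F n in sequentially. 0 \<le> log 2 (log 2 (real n))" by real_asymp
    ultimately show "\<forall>\<^sub>F n in sequentially. s n \<le> \<eta> * log 2 (l n)"
      by eventually_elim (auto simp: l_def)
    show "filterlim (\<lambda>n. \<eta> * log 2 (l n)) at_top sequentially"
      unfolding l_def using \<eta> by real_asymp
    show "\<eta> * log 2 (l m) \<le> \<eta> * log 2 (l n)" if "2 \<le> m" "m \<le> n" for m n
    proof -
      have "0 < log 2 (real m)" "log 2 (real m) \<le> log 2 (real n)" using that by auto
      then show ?thesis using \<eta> unfolding l_def by (intro mult_left_mono) auto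
    qed
  qed
  have T\<tau>: "\<forall>\<^sub>F n in sequentially. \<forall>m\<le>n. T m \<le> \<tau> n"
    unfolding \<tau>_def l_def using b
    by (intro running_bound[where k = 1] T time_bound_at_top mono_time_bound) auto
  have big: "\<forall>\<^sub>F n in sequentially. 1 \<le> l n \<and> 1 \<le> n"
    using lim_l eventually_ge_at_top[of 1] by (auto simp: filterlim_at_top intro: eventually_conj)
  note ev = eventually_bucket_count_le[OF b(1) \<theta>(1,2) \<gamma>(1), of "ln (4 / \<gamma> * (4 / \<gamma> + 3))"]
    eventually_powr_exponent_le[OF b(1) \<theta>(1,3)] eventually_memory_count_le[OF \<theta>(1), of "real C"]
  have ev1: "\<forall>\<^sub>F n in sequentially. 2 + 8 / \<gamma> * l n powr \<theta> * (ln (4 / \<gamma> * (4 / \<gamma> + 3)) + 2 powr (l n powr b) + l n powr \<theta>) \<le> 2 powr (2 * l n powr b)"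
    using ev(1) lim_l by (rule eventually_compose_filterlim)
  have ev2: "\<forall>\<^sub>F n in sequentially. 4 * l n powr (b + 2 * \<theta>) \<le> l n"
    using ev(2) lim_l by (rule eventually_compose_filterlim)
  have ev3: "\<forall>\<^sub>F n in sequentially. (real C)\<^sup>2 * l n powr (\<theta> / 2) \<le> l n powr \<theta>"
    using ev(3) C lim_l by (intro eventually_compose_filterlim[where f = l]) auto
  have "\<forall>\<^sub>F n in sequentially. similarity_upto L n (f n) \<and> (card (range (f n)))\<^sup>2 \<le> n"
    using sN T\<tau> big ev1 ev2 ev3
  proof eventually_elim
    case (elim n)
    have "4 * \<tau> n / \<gamma> \<le> real (t n)" and t2: "real (t n) \<le> 4 * \<tau> n / \<gamma> + 2" and "0 < t n"
      using \<tau>1[of n] \<gamma> unfolding t_def by (simp_all add: of_nat_ceiling) linarith+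
    have "similarity_upto L n (f n)"
      unfolding f_def \<mu>_def \<beta>_def G_def \<gamma>_def
    proof (rule signature_similarity[OF M \<epsilon> acc rej])
      show "\<exists>s\<le>real (N n). runs_within_space M w s" if "length w \<le> n" for w
      proof (intro exI conjI)
        have "s (length w) \<le> \<eta> * log 2 (l n)" using elim(1) that by blast
        also have "\<dots> \<le> real (N n)" unfolding N_def by linarith
        finally show "s (length w) \<le> real (N n)" .
      qed (rule space)
      show "cond_expected_time M w \<le> ennreal (\<tau> n)" if "length w \<le> n" for w
        using time[of w] elim(2) that by (meson ennreal_leI order_trans)
      show "0 \<le> \<tau> n" using \<tau>1[of n] by simp
      show "0 < t n" by fact
      show "4 * \<tau> n / (1 / 2 - \<epsilon>) \<le> real (t n)" using \<open>4 * \<tau> n / \<gamma> \<le> real (t n)\<close> by (simp add: \<gamma>_def)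
    qed
    moreover have "(card (range (f n)))\<^sup>2 \<le> n"
    proof -
      let ?c = "card (G n)" and ?B = "2 + nat \<lfloor>ln (1 / \<mu> n) / \<beta> n\<rfloor>"
      have "real (?c + 3) \<le> real (C ^ (N n + 1))"
        using card_bounded_mem_le[of M "N n"] unfolding G_def C_def by (intro of_nat_mono) simp
      also have "\<dots> = real C powr (real (N n) + 1)"
        using C by (simp add: powr_add powr_realpow)
      also have "\<dots> \<le> real C powr (\<eta> * log 2 (l n) + 2)"
      proof (rule powr_mono)
        have "0 \<le> \<eta> * log 2 (l n)" using \<eta> elim(3) by auto
        then show "real (N n) + 1 \<le> \<eta> * log 2 (l n) + 2" unfolding N_def by linarith
      qed (use C in simp)
      also have "\<dots> = (real C)\<^sup>2 * l n powr (\<theta> / 2)"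
      proof -
        have "real C powr (\<eta> * log 2 (l n)) = l n powr (\<theta> / 2)"
        proof -
          have "real C powr (\<eta> * log 2 (l n)) = 2 powr (log 2 (real C) * (\<eta> * log 2 (l n)))"
            using C by (simp flip: powr_powr)
          also have "log 2 (real C) * (\<eta> * log 2 (l n)) = log 2 (l n) * (\<theta> / 2)"
          proof -
            have "0 < log 2 (real C)" using C by simp
            then show ?thesis unfolding \<eta>_def by (simp add: field_simps)
          qed
          also have "2 powr (log 2 (l n) * (\<theta> / 2)) = l n powr (\<theta> / 2)"
            using elim(3) powr_powr[of 2 "log 2 (l n)" "\<theta> / 2"] by simp
          finally show ?thesis .
        qed
        then show ?thesis using C by (simp add: powr_add)
      qed
      also note elim(6)
      finally have c: "real ?c + 3 \<le> l n powr \<theta>" by simp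
      have B: "real ?B \<le> 2 + ln (1 / \<mu> n) / \<beta> n"
      proof -
        have "\<mu> n \<le> 1"
        proof -
          have "1 * 1 \<le> (4 * real (t n + 1)) * real (?c + 3)" by (intro mult_mono) auto
          then have "1 \<le> 4 * real (t n + 1) * real (?c + 3)" by simp
          then show ?thesis using \<gamma> unfolding \<mu>_def by (subst divide_le_eq_1_pos) auto
        qed
        then have "0 \<le> ln (1 / \<mu> n) / \<beta> n" using \<mu>[of n] \<beta>[of n] by simp
        then show ?thesis by linarith
      qed
      have "1 * 1 \<le> 4 / \<gamma> * (4 / \<gamma> + 3)" using \<gamma> by (intro mult_mono) (auto simp: field_simps)
      then have "0 \<le> ln (4 / \<gamma> * (4 / \<gamma> + 3))" by simp
      from signature_count_le[OF \<gamma>(1) _ t2 c _ B[unfolded \<mu>_def \<beta>_def] elim(4,5) this]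
      have bound: "real ((?B ^ ((?c + 1) * (?c + 3)))\<^sup>2) \<le> 2 powr l n"
        using elim(3) by (simp add: \<tau>_def \<mu>_def \<beta>_def)
      have "2 powr l n = real n" using elim(3) by (simp add: l_def)
      then have "(?B ^ ((?c + 1) * (?c + 3)))\<^sup>2 \<le> n" using bound by (simp only: of_nat_le_iff)
      moreover have "(card (range (f n)))\<^sup>2 \<le> (?B ^ ((?c + 1) * (?c + 3)))\<^sup>2"
        unfolding f_def by (intro power_mono card_signature G \<mu> \<beta>) simp
      ultimately show ?thesis by linarith
    qed
    ultimately show ?case by blast
  qed
  then obtain n0 where n0: "\<And>n. n0 \<le> n \<Longrightarrow> similarity_upto L n (f n)"
    "\<And>n. n0 \<le> n \<Longrightarrow> (card (range (f n)))\<^sup>2 \<le> n"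
    by (auto simp: eventually_sequentially)
  show ?thesis
  proof (rule regular_if_few_classes[of n0 f])
    show "finite (range (f n))" for n unfolding f_def by (intro card_signature G \<mu> \<beta>)
    show "w' @ v \<in> L" if "n0 \<le> n" "f n w = f n w'" "length (w @ v) \<le> n" "length (w' @ v) \<le> n" "w @ v \<in> L"
      for n w w' v using n0(1)[OF that(1)] that unfolding similarity_upto_def by blast
  qed (rule n0(2))
qed

theorem theorem4:
  fixes M :: "('q::finite, 'g::finite, 'a::finite) ptm"
    and L :: "'a list set"
    and s T :: "nat \<Rightarrow> real"
    and h :: "'a list \<Rightarrow> real"
  assumes "is_ptm M"
    and "recognizes M L"
    and "\<not> regular_lang L"
    and "s \<in> o(\<lambda>n. log 2 (log 2 (real n)))"
    and "\<And>w. runs_within_space M w (s (length w))"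
    and "\<And>w. halt_prob M w = h w"
    and "\<And>w. h w \<le> 1"
    and "\<And>w. cond_expected_time M w \<le> ennreal (T (length w))"
  shows "(\<forall>b<1. infinite {n. 1 < T n \<and> log 2 (log 2 (T n)) \<ge> log 2 (real n) powr b}) \<and>
         \<not> (\<exists>p :: real poly. \<forall>n. T n \<le> poly p (real n))"
proof -
  have slow: "infinite {n. 1 < T n \<and> log 2 (log 2 (T n)) \<ge> log 2 (real n) powr b}" if "b < 1" for b
  proof
    assume fin: "finite {n. 1 < T n \<and> log 2 (log 2 (T n)) \<ge> log 2 (real n) powr b}"
    \<comment> \<open>Zero and negative exponents are reduced to a positive one; raising the
      exponent is harmless once \<open>log 2 (real n)\<close> is at least 1.\<close>
    define b' where "b' = max b (1 / 2)"
    have b': "0 < b'" "b' < 1" "b \<le> b'" using that by (auto simp: b'_def)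
    have "\<forall>\<^sub>F n in sequentially. n \<notin> {n. 1 < T n \<and> log 2 (log 2 (T n)) \<ge> log 2 (real n) powr b}"
      using fin by (simp add: cofinite_eq_sequentially[symmetric] eventually_cofinite)
    moreover have "\<forall>\<^sub>F n in sequentially. 1 \<le> log 2 (real n)" by real_asymp
    ultimately have "\<forall>\<^sub>F n in sequentially. T n \<le> 2 powr (2 powr (log 2 (real n) powr b'))"
    proof eventually_elim
      case (elim n)
      show ?case
      proof (cases "1 < T n")
        case True
        then have "log 2 (log 2 (T n)) \<le> log 2 (real n) powr b" using elim(1) by simp
        also have "\<dots> \<le> log 2 (real n) powr b'" using elim(2) b' by (intro powr_mono) auto
        finally have "log 2 (T n) \<le> 2 powr (log 2 (real n) powr b')"
          using True by (subst (asm) log_le_iff) auto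
        then show ?thesis using True by (subst (asm) log_le_iff) auto
      next
        case False
        have "1 \<le> 2 powr (2 powr (log 2 (real n) powr b'))" by (intro ge_one_powr_ge_zero) auto
        then show ?thesis using False by linarith
      qed
    qed
    then have "regular_lang L"
      by (rule regular_if_fast[OF assms(1,2,4,5,8) b'(1,2)])
    then show False using assms(3) by blast
  qed
  have "\<not> (\<forall>n. T n \<le> poly p (real n))" for p :: "real poly"
  proof
    assume p: "\<forall>n. T n \<le> poly p (real n)"
    \<comment> \<open>The summand 1 and the \<open>Suc\<close> in \<open>k\<close> ensure
      \<open>1 \<le> c\<close> and \<open>0 < k\<close> even for constant \<open>p\<close>. The
      iterated logarithm of the bound then grows like log log n, slower than (log n)^(1/2), which
      contradicts the first part for b = 1/2.\<close>
    define c where "c = 1 + (\<Sum>i\<le>degree p. \<bar>coeff p i\<bar>)"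
    define k where "k = real (Suc (degree p))"
    have c: "1 \<le> c" unfolding c_def by (simp add: sum_nonneg)
    have "\<forall>\<^sub>F x in at_top. log 2 (log 2 c + k * x) < x powr (1 / 2)"
      by (rule eventually_log_linear_less) (simp add: k_def)
    then have "\<forall>\<^sub>F n in sequentially. log 2 (log 2 c + k * log 2 (real n)) < log 2 (real n) powr (1 / 2)"
      by (rule eventually_compose_filterlim) real_asymp
    moreover have "\<forall>\<^sub>F n in sequentially. (1 :: nat) \<le> n" by (rule eventually_ge_at_top)
    ultimately have "\<forall>\<^sub>F n in sequentially. \<not> (1 < T n \<and> log 2 (log 2 (T n)) \<ge> log 2 (real n) powr (1 / 2))"
    proof eventually_elim
      case (elim n)
      show ?case
      proof
        assume *: "1 < T n \<and> log 2 (log 2 (T n)) \<ge> log 2 (real n) powr (1 / 2)"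
        have "T n \<le> c * real n ^ Suc (degree p)"
          using p[rule_format, of n] poly_le_power[of "real n" p] elim(2) unfolding c_def by simp
        then have "log 2 (T n) \<le> log 2 (c * real n ^ Suc (degree p))" using * by simp
        also have "\<dots> = log 2 c + k * log 2 (real n)"
          using c elim(2) unfolding k_def by (subst log_mult_pos) (simp_all add: log_nat_power del: power_Suc)
        finally have "log 2 (log 2 (T n)) \<le> log 2 (log 2 c + k * log 2 (real n))"
          using * by (intro log_mono) auto
        then show False using elim(1) * by linarith
      qed
    qed
    then have "finite {n. 1 < T n \<and> log 2 (log 2 (T n)) \<ge> log 2 (real n) powr (1 / 2)}"
      by (simp add: cofinite_eq_sequentially[symmetric] eventually_cofinite)
    then show False using slow[of "1 / 2"] by simp
  qed
  with slow show ?thesis by blast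
qed

end
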